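(* Let $2<p<\infty$ and let $w=(w_n)$ be a sequence of positive reals with $w_n\to0$ and $\sum_n w_n^{2p/(p-2)}=\infty$. Then the Rosenthal space $X_{p,w}$ is isomorphic to a $7.35\,(p/\log p)$-orthogonally complemented subspace of $L_p[0,1]$ (with $\log$ the natural logarithm).
   Context: For $2<p<\infty$ and a sequence $w=(w_n)$ of positive reals, $X_{p,w}$ is the space of real sequences $(x_n)$ with $(x_n)\in\ell_p$ and $(x_nw_n)\in\ell_2$, with norm $\|(x_n)\|=\max\{\|(x_n)\|_{\ell_p},\|(x_nw_n)\|_{\ell_2}\}$. For a probability space $(\Omega,\mathcal A,\mu)$ and $C>0$, an orthogonal projection $P$ on $L_2(\Omega)$ is $p$-$C$-bounded if $\|Pf\|_p\le C\|f\|_p$ for all $f\in L_2\cap L_p$; a subspace $X\subseteq L_p(\Omega)$ is $C$-orthogonally complemented if it is the $\|\cdot\|_p$-closure of $P(L_2\cap L_p)$ for some $p$-$C$-bounded orthogonal projection $P$. *)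

theory Defs
  imports "HOL-Analysis.Analysis"
begin

abbreviation U :: "real measure" where "U \<equiv> lebesgue_on {0..1}"

text \<open>Membership in L_q[0,1] (functions, with a.e. identification handled explicitly).\<close>
definition memLq :: "real \<Rightarrow> (real \<Rightarrow> real) \<Rightarrow> bool" where
  "memLq q f \<longleftrightarrow> f \<in> borel_measurable U \<and> integrable U (\<lambda>t. \<bar>f t\<bar> powr q)"

definition normLq :: "real \<Rightarrow> (real \<Rightarrow> real) \<Rightarrow> real" where
  "normLq q f = (integral\<^sup>L U (\<lambda>t. \<bar>f t\<bar> powr q)) powr (1 / q)"

definition ae_eq :: "(real \<Rightarrow> real) \<Rightarrow> (real \<Rightarrow> real) \<Rightarrow> bool" where
  "ae_eq f g \<longleftrightarrow> (AE t in U. f t = g t)"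

definition orth_proj_L2 :: "((real \<Rightarrow> real) \<Rightarrow> (real \<Rightarrow> real)) \<Rightarrow> bool" where
  "orth_proj_L2 P \<longleftrightarrow>
     (\<forall>f. memLq 2 f \<longrightarrow> memLq 2 (P f)) \<and>
     (\<forall>f g. memLq 2 f \<longrightarrow> memLq 2 g \<longrightarrow> ae_eq f g \<longrightarrow> ae_eq (P f) (P g)) \<and>
     (\<forall>f g a b. memLq 2 f \<longrightarrow> memLq 2 g \<longrightarrow>
        ae_eq (P (\<lambda>t. a * f t + b * g t)) (\<lambda>t. a * P f t + b * P g t)) \<and>
     (\<forall>f. memLq 2 f \<longrightarrow> ae_eq (P (P f)) (P f)) \<and>
     (\<forall>f g. memLq 2 f \<longrightarrow> memLq 2 g \<longrightarrow>
        integral\<^sup>L U (\<lambda>t. P f t * g t) = integral\<^sup>L U (\<lambda>t. f t * P g t))"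

definition p_C_bounded :: "real \<Rightarrow> real \<Rightarrow> ((real \<Rightarrow> real) \<Rightarrow> (real \<Rightarrow> real)) \<Rightarrow> bool" where
  "p_C_bounded p C P \<longleftrightarrow>
     (\<forall>f. memLq 2 f \<and> memLq p f \<longrightarrow> memLq p (P f) \<and> normLq p (P f) \<le> C * normLq p f)"

definition Lp_closure_range :: "real \<Rightarrow> ((real \<Rightarrow> real) \<Rightarrow> (real \<Rightarrow> real)) \<Rightarrow> (real \<Rightarrow> real) set" where
  "Lp_closure_range p P = {g. memLq p g \<and>
     (\<forall>e>0. \<exists>f. memLq 2 f \<and> memLq p f \<and> normLq p (\<lambda>t. g t - P f t) < e)}"

definition C_orth_complemented :: "real \<Rightarrow> real \<Rightarrow> (real \<Rightarrow> real) set \<Rightarrow> bool" where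
  "C_orth_complemented p C X \<longleftrightarrow>
     (\<exists>P. orth_proj_L2 P \<and> p_C_bounded p C P \<and> X = Lp_closure_range p P)"

definition in_Xpw :: "real \<Rightarrow> (nat \<Rightarrow> real) \<Rightarrow> (nat \<Rightarrow> real) \<Rightarrow> bool" where
  "in_Xpw p w x \<longleftrightarrow> summable (\<lambda>n. \<bar>x n\<bar> powr p) \<and> summable (\<lambda>n. (x n * w n)\<^sup>2)"

definition norm_Xpw :: "real \<Rightarrow> (nat \<Rightarrow> real) \<Rightarrow> (nat \<Rightarrow> real) \<Rightarrow> real" where
  "norm_Xpw p w x = max ((\<Sum>n. \<bar>x n\<bar> powr p) powr (1 / p)) (sqrt (\<Sum>n. (x n * w n)\<^sup>2))"

definition Xpw_isomorphic_to :: "real \<Rightarrow> (nat \<Rightarrow> real) \<Rightarrow> (real \<Rightarrow> real) set \<Rightarrow> bool" where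
  "Xpw_isomorphic_to p w X \<longleftrightarrow>
     (\<exists>T :: (nat \<Rightarrow> real) \<Rightarrow> (real \<Rightarrow> real). \<exists>a b. 0 < a \<and> 0 < b \<and>
        (\<forall>x. in_Xpw p w x \<longrightarrow> T x \<in> X) \<and>
        (\<forall>x y c d. in_Xpw p w x \<longrightarrow> in_Xpw p w y \<longrightarrow>
            ae_eq (T (\<lambda>n. c * x n + d * y n)) (\<lambda>t. c * T x t + d * T y t)) \<and>
        (\<forall>x. in_Xpw p w x \<longrightarrow>
            a * norm_Xpw p w x \<le> normLq p (T x) \<and> normLq p (T x) \<le> b * norm_Xpw p w x) \<and>
        (\<forall>g\<in>X. \<exists>x. in_Xpw p w x \<and> ae_eq (T x) g))"

end

theory Submission
  imports Defs
begin

text \<open>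
  Let \<open>f\<^sub>n\<close> be independent symmetric functions on \<open>[0,1]\<close> with \<open>\<bar>f\<^sub>n\<bar>\<close> the indicator of a set of measure
  \<open>m\<^sub>n\<close>, where \<open>m\<^sub>n\<close> is comparable to \<open>w\<^sub>n\<^bsup>2p/(p-2)\<^esup>\<close>, and let \<open>P\<close> be the orthogonal projection onto
  their closed span, with coefficients \<open>b\<^sub>n = \<langle>g, f\<^sub>n\<rangle> / m\<^sub>n\<close>. Two estimates control \<open>P\<close> on \<open>L\<^sub>p\<close>.
  First, \<open>\<Sum> \<bar>b\<^sub>n\<bar>\<^sup>p m\<^sub>n \<le> \<integral> \<bar>g\<bar>\<^sup>p\<close>, which is dual to the type \<open>q\<close> inequality
  \<open>\<integral> \<bar>\<Sum> d\<^sub>n f\<^sub>n\<bar>\<^sup>q \<le> \<Sum> \<bar>d\<^sub>n\<bar>\<^sup>q m\<^sub>n\<close> for the conjugate exponent \<open>q \<le> 2\<close>; together with Bessel's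
  inequality it also gives the lower estimate of the isomorphism. Second, Rosenthal's inequality
  \<open>\<parallel>\<Sum> c\<^sub>n f\<^sub>n\<parallel>\<^sub>p \<le> 6.8 (p / ln p) max {(\<Sum> \<bar>c\<^sub>n\<bar>\<^sup>p m\<^sub>n)\<^bsup>1/p\<^esup>, (\<Sum> c\<^sub>n\<^sup>2 m\<^sub>n)\<^bsup>1/2\<^esup>}\<close>. With the maximum
  normalised to 1, the terms with \<open>\<bar>c\<^sub>n\<bar> \<le> 2\<close> have exponential moments
  \<open>\<integral> cosh (l S) \<le> exp (\<Sum> m\<^sub>n (cosh (l c\<^sub>n) - 1)) \<le> exp (p/8)\<close> at \<open>l = (ln p)/2\<close>, and the supports of the terms
  with \<open>\<bar>c\<^sub>n\<bar> > 2\<close> have total measure at most \<open>2\<^bsup>-p\<^esup>\<close>, so that even \<open>\<bar>x + y\<bar>\<^sup>p \<le> 2\<^bsup>p-1\<^esup> (\<bar>x\<bar>\<^sup>p + \<bar>y\<bar>\<^sup>p)\<close>,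
  applied once per term, loses only a bounded factor.
\<close>

subsection \<open>Elementary inequalities\<close>

lemma powr_midpoint_le:
  fixes x y r :: real
  assumes "0 \<le> x" "0 \<le> y" "1 \<le> r"
  shows "((x + y) / 2) powr r \<le> (x powr r + y powr r) / 2"
proof -
  have half: "(z / 2) powr r \<le> z powr r / 2" if "0 \<le> z" for z :: real
  proof -
    have "(1/2::real) powr r \<le> (1/2) powr 1"
      using assms(3) by (intro powr_mono') auto
    then have "z powr r * (1/2) powr r \<le> z powr r * (1/2)"
      by (intro mult_left_mono) auto
    then show ?thesis
      using that by (simp add: powr_divide powr_mult)
  qed
  consider "x = 0" | "y = 0" | "0 < x" "0 < y"
    using assms by linarith
  then show ?thesis
  proof cases
    case 3
    then show ?thesis
      using convex_onD[OF powr_convex[OF assms(3)], of "1/2" x y]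
      by (simp add: add_divide_distrib algebra_simps)
  qed (use half assms in auto)
qed

lemma abs_add_powr_le:
  fixes x y r :: real
  assumes "1 \<le> r"
  shows "\<bar>x + y\<bar> powr r \<le> 2 powr (r - 1) * (\<bar>x\<bar> powr r + \<bar>y\<bar> powr r)"
proof -
  have "\<bar>x + y\<bar> powr r \<le> (\<bar>x\<bar> + \<bar>y\<bar>) powr r"
    using assms by (intro powr_mono2) auto
  also have "\<dots> = 2 powr r * ((\<bar>x\<bar> + \<bar>y\<bar>) / 2) powr r"
    by (simp add: powr_divide)
  also have "\<dots> \<le> 2 powr r * ((\<bar>x\<bar> powr r + \<bar>y\<bar> powr r) / 2)"
    using assms by (intro mult_left_mono powr_midpoint_le) auto
  also have "\<dots> = 2 powr (r - 1) * (\<bar>x\<bar> powr r + \<bar>y\<bar> powr r)"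
    by (simp add: powr_diff)
  finally show ?thesis .
qed

lemma powr_add_subadditive:
  fixes u v r :: real
  assumes "0 \<le> u" "0 \<le> v" "0 < r" "r \<le> 1"
  shows "(u + v) powr r \<le> u powr r + v powr r"
proof (cases "u + v = 0")
  case False
  then have s: "0 < u + v" using assms by linarith
  have le: "z / (u + v) \<le> (z / (u + v)) powr r" if "0 \<le> z" "z \<le> u + v" for z
  proof (cases "z = 0")
    case False
    then have "(z / (u + v)) powr 1 \<le> (z / (u + v)) powr r"
      using that s assms by (intro powr_mono') auto
    then show ?thesis using that s by simp
  qed auto
  have "1 = u / (u + v) + v / (u + v)"
    using s by (simp add: add_divide_distrib[symmetric])
  also have "\<dots> \<le> (u / (u + v)) powr r + (v / (u + v)) powr r"
    using assms by (intro add_mono le) auto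
  also have "\<dots> = (u powr r + v powr r) / (u + v) powr r"
    using assms s by (simp add: powr_divide add_divide_distrib)
  finally show ?thesis
    using s by (simp add: field_simps)
qed (use assms in auto)

lemma two_point_powr_le:
  fixes x y q :: real
  assumes "1 \<le> q" "q \<le> 2"
  shows "(\<bar>x + y\<bar> powr q + \<bar>x - y\<bar> powr q) / 2 \<le> \<bar>x\<bar> powr q + \<bar>y\<bar> powr q"
proof -
  have sq: "(z\<^sup>2) powr (q / 2) = \<bar>z\<bar> powr q" and qs: "(\<bar>z\<bar> powr q) powr (2 / q) = z\<^sup>2" for z :: real
  proof -
    have *: "z\<^sup>2 = \<bar>z\<bar> powr 2"
      by (cases "z = 0") (simp_all add: powr_numeral)
    show "(z\<^sup>2) powr (q / 2) = \<bar>z\<bar> powr q" "(\<bar>z\<bar> powr q) powr (2 / q) = z\<^sup>2"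
      unfolding * powr_powr using assms by simp_all
  qed
  let ?m = "(\<bar>x + y\<bar> powr q + \<bar>x - y\<bar> powr q) / 2"
  have "?m powr (2 / q) \<le> ((x + y)\<^sup>2 + (x - y)\<^sup>2) / 2"
    using powr_midpoint_le[of "\<bar>x + y\<bar> powr q" "\<bar>x - y\<bar> powr q" "2 / q"] assms
    by (simp add: qs)
  also have "\<dots> = x\<^sup>2 + y\<^sup>2"
    by (simp add: power2_eq_square algebra_simps)
  finally have "(?m powr (2 / q)) powr (q / 2) \<le> (x\<^sup>2 + y\<^sup>2) powr (q / 2)"
    using assms by (intro powr_mono2) auto
  also have "\<dots> \<le> (x\<^sup>2) powr (q / 2) + (y\<^sup>2) powr (q / 2)"
    using assms by (intro powr_add_subadditive) auto
  finally show ?thesis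
    using assms by (simp add: powr_powr sq)
qed

lemma continuous_on_abs_powr: "0 < q \<Longrightarrow> continuous_on UNIV (\<lambda>x::real. \<bar>x\<bar> powr q)"
  by (intro continuous_on_powr') (auto intro!: continuous_intros)

lemma cosh_mult_le:
  fixes \<theta> y :: real
  assumes "\<bar>\<theta>\<bar> \<le> 1"
  shows "cosh (\<theta> * y) - 1 \<le> \<theta>\<^sup>2 * (cosh y - 1)"
proof -
  let ?a = "\<lambda>n. if even n then y ^ n /\<^sub>R fact n else 0"
  have R: "(\<lambda>n. (if n = 0 then 1 - \<theta>\<^sup>2 else 0) + \<theta>\<^sup>2 * ?a n) sums ((1 - \<theta>\<^sup>2) + \<theta>\<^sup>2 * cosh y)"
    by (intro sums_add sums_mult cosh_converges sums_If_finite_set[of "{0}" "\<lambda>_. 1 - \<theta>\<^sup>2", simplified])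
  have le: "(if even n then (\<theta> * y) ^ n /\<^sub>R fact n else 0)
      \<le> (if n = 0 then 1 - \<theta>\<^sup>2 else 0) + \<theta>\<^sup>2 * ?a n" for n
  proof (cases "even n \<and> n \<noteq> 0")
    case True
    then have n2: "2 \<le> n" by (auto elim: evenE)
    have "\<theta> ^ n = \<bar>\<theta>\<bar> ^ n"
      using True by (simp add: power_even_abs)
    also have "\<dots> \<le> \<bar>\<theta>\<bar> ^ 2"
      using assms n2 by (intro power_decreasing) auto
    finally have "\<theta> ^ n * (y ^ n / fact n) \<le> \<theta>\<^sup>2 * (y ^ n / fact n)"
      using True by (intro mult_right_mono) (auto intro!: divide_nonneg_pos zero_le_even_power)
    then show ?thesis
      using True by (simp add: power_mult_distrib field_simps)
  qed auto
  show ?thesis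
    using sums_le[OF le cosh_converges R] by (simp add: algebra_simps)
qed

lemma abs_powr_le_cosh:
  fixes x l p :: real
  assumes "0 < l" "0 < p"
  shows "\<bar>x\<bar> powr p \<le> 2 * (p / l) powr p * cosh (l * x)"
proof -
  have "l * \<bar>x\<bar> / p \<le> exp (l * \<bar>x\<bar> / p)"
    using exp_ge_add_one_self[of "l * \<bar>x\<bar> / p"] by linarith
  then have "(l * \<bar>x\<bar> / p) powr p \<le> exp (l * \<bar>x\<bar> / p) powr p"
    using assms by (intro powr_mono2) auto
  also have "\<dots> = exp (l * \<bar>x\<bar>)"
    using assms by (simp add: powr_def)
  also have "\<dots> \<le> 2 * cosh (l * \<bar>x\<bar>)"
    by (simp add: cosh_field_def)
  also have "cosh (l * \<bar>x\<bar>) = cosh (l * x)"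
    using cosh_real_abs[of "l * x"] assms by (simp add: abs_mult)
  finally have "(p / l) powr p * (l * \<bar>x\<bar> / p) powr p \<le> (p / l) powr p * (2 * cosh (l * x))"
    by (intro mult_left_mono) auto
  moreover have "(p / l) powr p * (l * \<bar>x\<bar> / p) powr p = \<bar>x\<bar> powr p"
    using assms by (simp flip: powr_mult)
  ultimately show ?thesis by simp
qed

subsection \<open>Independent symmetric three-valued functions on the unit interval\<close>

lemma prob_unit_interval: "finite_measure U" "measure U {0..1} = 1"
  by (auto intro!: finite_measure_lebesgue_on simp: measure_restrict_space space_restrict_space)

interpretation U: finite_measure U
  by (rule prob_unit_interval)

lemma integral_lebesgue_on_unit_floor:
  fixes F :: "nat \<Rightarrow> real"
  assumes "0 < L"
  shows "integral\<^sup>L U (\<lambda>t. F (nat \<lfloor>real L * t\<rfloor>)) = (\<Sum>j<L. F j) / real L"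
proof -
  let ?I = "\<lambda>j::nat. {real j / real L..<real (Suc j) / real L}"
  have sub: "?I j \<subseteq> {0..1}" if "j < L" for j
  proof -
    have "real (Suc j) / real L \<le> 1" using that by simp
    moreover have "0 \<le> real j / real L" by simp
    ultimately show ?thesis by (meson atLeastLessThan_subseteq_atLeastAtMost_iff order_trans)
  qed
  have meas: "measure U (?I j) = 1 / real L" "?I j \<in> sets U" if "j < L" for j
  proof -
    show "?I j \<in> sets U" using sub[OF that] by (auto simp: sets_restrict_space)
    have "real j / real L \<le> real (Suc j) / real L"
      using assms by (simp add: divide_right_mono)
    then show "measure U (?I j) = 1 / real L"
      using sub[OF that] assms
      by (subst measure_restrict_space) (auto simp: diff_divide_distrib[symmetric])
  qed
  have fl: "nat \<lfloor>real L * t\<rfloor> = j \<longleftrightarrow> t \<in> ?I j" if "0 \<le> t" for t j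
  proof -
    have "nat \<lfloor>real L * t\<rfloor> = j \<longleftrightarrow> \<lfloor>real L * t\<rfloor> = int j"
      using that by auto
    also have "\<dots> \<longleftrightarrow> t \<in> ?I j"
      using assms by (auto simp: floor_eq_iff field_simps)
    finally show ?thesis .
  qed
  have ne1: "AE t in U. t \<noteq> 1"
  proof (rule AE_I')
    show "{1} \<in> null_sets U"
      by (auto simp: null_sets_restrict_space)
  qed auto
  have "integral\<^sup>L U (\<lambda>t. F (nat \<lfloor>real L * t\<rfloor>)) = integral\<^sup>L U (\<lambda>t. \<Sum>j<L. F j * indicator (?I j) t)"
  proof (rule integral_cong_AE)
    have "(\<lambda>t. F (nat \<lfloor>real L * t\<rfloor>)) \<in> borel_measurable borel"
      by measurable
    then show "(\<lambda>t. F (nat \<lfloor>real L * t\<rfloor>)) \<in> borel_measurable U"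
      by (auto intro!: measurable_restrict_space1 measurable_completion)
    show "(\<lambda>t. \<Sum>j<L. F j * indicator (?I j) t) \<in> borel_measurable U"
      using meas(2)
      by (intro borel_measurable_sum borel_measurable_times borel_measurable_const borel_measurable_indicator) simp_all
    show "AE t in U. F (nat \<lfloor>real L * t\<rfloor>) = (\<Sum>j<L. F j * indicator (?I j) t)"
      using ne1
    proof (rule AE_mp, intro AE_I2 impI)
      fix t assume t: "t \<in> space U" "t \<noteq> 1"
      then have t01: "0 \<le> t" "t < 1" by (auto simp: space_restrict_space)
      have "real L * t < real L" using t01 assms by simp
      then have j: "nat \<lfloor>real L * t\<rfloor> < L"
        using t01 by (simp add: nat_less_iff floor_less_iff)
      have "(\<Sum>j<L. F j * indicator (?I j) t)
          = (\<Sum>j<L. if j = nat \<lfloor>real L * t\<rfloor> then F j else 0)"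
      proof (intro sum.cong refl)
        fix j
        show "F j * indicator (?I j) t = (if j = nat \<lfloor>real L * t\<rfloor> then F j else 0)"
          unfolding indicator_def fl[OF t01(1), symmetric] by simp
      qed
      then show "F (nat \<lfloor>real L * t\<rfloor>) = (\<Sum>j<L. F j * indicator (?I j) t)"
        using j by simp
    qed
  qed
  also have "\<dots> = (\<Sum>j<L. integral\<^sup>L U (\<lambda>t. F j * indicator (?I j) t))"
    using meas by (intro Bochner_Integration.integral_sum)
      (auto intro!: integrable_mult_right integrable_real_indicator
        simp: U.emeasure_finite less_top[symmetric])
  also have "\<dots> = (\<Sum>j<L. F j * (1 / real L))"
    using meas sub by (intro sum.cong refl) (simp add: space_restrict_space Int_absorb2)
  finally show ?thesis by (simp add: sum_divide_distrib)
qed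

text \<open>\<open>spike_fun M n\<close> reads off the \<open>n\<close>-th digit of the expansion of \<open>t\<close> in the mixed radix
  \<open>M 0, M 1, \<dots>\<close>, and \<open>spike_code M c N j\<close> is the value of the \<open>N\<close>-th partial sum on the \<open>j\<close>-th
  interval of length \<open>1 / (M 0 \<cdots> M (N - 1))\<close>.\<close>

definition spike :: "nat \<Rightarrow> real" where
  "spike k = (if k = 0 then 1 else if k = 1 then - 1 else 0)"

definition spike_fun :: "(nat \<Rightarrow> nat) \<Rightarrow> nat \<Rightarrow> real \<Rightarrow> real" where
  "spike_fun M n t = spike (nat \<lfloor>real (\<Prod>i\<le>n. M i) * t\<rfloor> mod M n)"

fun spike_code :: "(nat \<Rightarrow> nat) \<Rightarrow> (nat \<Rightarrow> real) \<Rightarrow> nat \<Rightarrow> nat \<Rightarrow> real" where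
  "spike_code M c 0 j = 0"
| "spike_code M c (Suc N) j = spike_code M c N (j div M N) + c N * spike (j mod M N)"

lemma sum_spike_fun_eq_code:
  assumes "0 \<le> t" and "\<And>n. 0 < M n"
  shows "(\<Sum>n<N. c n * spike_fun M n t) = spike_code M c N (nat \<lfloor>real (\<Prod>i<N. M i) * t\<rfloor>)"
proof (induction N)
  case (Suc N)
  let ?x = "real (\<Prod>i<Suc N. M i) * t"
  have "real (\<Prod>i<N. M i) * t = ?x / real_of_int (int (M N))"
    using assms(2)[of N] by simp
  then have "\<lfloor>real (\<Prod>i<N. M i) * t\<rfloor> = \<lfloor>?x\<rfloor> div int (M N)"
    using floor_divide_real_eq_div[of "int (M N)" ?x] by simp
  then have "nat \<lfloor>real (\<Prod>i<N. M i) * t\<rfloor> = nat \<lfloor>?x\<rfloor> div M N"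
    using assms(1) by (simp add: nat_div_distrib prod_nonneg)
  then show ?case
    using Suc.IH by (simp add: spike_fun_def flip: lessThan_Suc_atMost)
qed simp

lemma sum_div_mod_split:
  fixes F :: "nat \<Rightarrow> nat \<Rightarrow> real"
  assumes "0 < K"
  shows "(\<Sum>j<D * K. F (j div K) (j mod K)) = (\<Sum>i<D. \<Sum>k<K. F i k)"
proof -
  have "(\<Sum>j<D * K. F (j div K) (j mod K)) = (\<Sum>i<D. \<Sum>j=i * K..<i * K + K. F (j div K) (j mod K))"
    by (rule sum.nat_group[symmetric])
  also have "\<dots> = (\<Sum>i<D. \<Sum>k<K. F i k)"
  proof (rule sum.cong[OF refl])
    fix i
    have "(\<Sum>j=i * K..<i * K + K. F (j div K) (j mod K))
        = (\<Sum>k=0..<K. F ((k + i * K) div K) ((k + i * K) mod K))"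
      using sum.shift_bounds_nat_ivl[of "\<lambda>j. F (j div K) (j mod K)" 0 "i * K" K] by (simp add: add.commute)
    also have "\<dots> = (\<Sum>k<K. F i k)"
      using assms by (intro sum.cong) (auto simp: atLeast0LessThan)
    finally show "(\<Sum>j=i * K..<i * K + K. F (j div K) (j mod K)) = (\<Sum>k<K. F i k)" .
  qed
  finally show ?thesis .
qed

lemma sum_spike:
  fixes \<phi> :: "real \<Rightarrow> real"
  assumes "2 \<le> K"
  shows "(\<Sum>k<K. \<phi> (x + a * spike k)) = \<phi> (x + a) + \<phi> (x - a) + (real K - 2) * \<phi> x"
proof -
  obtain L where L: "K = Suc (Suc L)"
    using assms by (metis Suc_le_D numeral_2_eq_2 Suc_le_mono)
  show ?thesis
    unfolding L sum.lessThan_Suc_shift by (simp add: spike_def)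
qed

text \<open>The partial sums of the \<open>f n\<close> have the law of a sum of independent symmetric variables, the
  \<open>n\<close>-th one being \<open>c n\<close>, \<open>- c n\<close> with probability \<open>m n / 2\<close> each and \<open>0\<close> otherwise. This one-step
  recursion is the only form of independence that is used.\<close>

locale symmetric_spikes =
  fixes f :: "nat \<Rightarrow> real \<Rightarrow> real" and m :: "nat \<Rightarrow> real"
  assumes m_pos: "0 < m n"
    and f_measurable [measurable]: "f n \<in> borel_measurable U"
    and f_bound: "\<bar>f n t\<bar> \<le> 1"
    and law: "continuous_on UNIV \<phi> \<Longrightarrow>
      (LINT t|U. \<phi> (\<Sum>n<Suc N. c n * f n t)) =
        (1 - m N) * (LINT t|U. \<phi> (\<Sum>n<N. c n * f n t))
        + m N / 2 * (LINT t|U. \<phi> ((\<Sum>n<N. c n * f n t) + c N))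
        + m N / 2 * (LINT t|U. \<phi> ((\<Sum>n<N. c n * f n t) - c N))"

lemma symmetric_spikes_spike_fun:
  assumes M2: "\<And>n. 2 \<le> M n"
  shows "symmetric_spikes (spike_fun M) (\<lambda>n. 2 / real (M n))"
proof
  fix n and t :: real
  have M: "0 < M k" for k using M2[of k] by simp
  show "0 < 2 / real (M n)" using M by simp
  have "spike_fun M n \<in> borel_measurable borel"
    unfolding spike_fun_def by measurable
  then show "spike_fun M n \<in> borel_measurable U"
    by (auto intro!: measurable_restrict_space1 measurable_completion)
  show "\<bar>spike_fun M n t\<bar> \<le> 1"
    by (simp add: spike_fun_def spike_def)
next
  fix \<phi> :: "real \<Rightarrow> real" and c :: "nat \<Rightarrow> real" and N
  have M: "0 < M k" for k using M2[of k] by simp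
  define D where "D N = (\<Prod>i<N. M i)" for N
  have D: "0 < D N" for N unfolding D_def using M by (simp add: prod_pos)
  have E: "(LINT t|U. \<psi> (\<Sum>n<N. c n * spike_fun M n t)) = (\<Sum>j<D N. \<psi> (spike_code M c N j)) / D N"
    for \<psi> :: "real \<Rightarrow> real" and N
  proof -
    have "(LINT t|U. \<psi> (\<Sum>n<N. c n * spike_fun M n t))
        = (LINT t|U. \<psi> (spike_code M c N (nat \<lfloor>real (D N) * t\<rfloor>)))"
      by (intro Bochner_Integration.integral_cong refl)
        (simp add: sum_spike_fun_eq_code[OF _ M] D_def space_restrict_space)
    then show ?thesis
      using integral_lebesgue_on_unit_floor[OF D, of "\<lambda>j. \<psi> (spike_code M c N j)" N] by simp
  qed
  have DS: "D (Suc N) = D N * M N" by (simp add: D_def)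
  let ?g = "spike_code M c N"
  have "(\<Sum>j<D (Suc N). \<phi> (spike_code M c (Suc N) j)) = (\<Sum>i<D N. \<Sum>k<M N. \<phi> (?g i + c N * spike k))"
    unfolding DS by (simp add: sum_div_mod_split[OF M, where F = "\<lambda>i k. \<phi> (?g i + c N * spike k)"])
  also have "\<dots> = (\<Sum>i<D N. \<phi> (?g i + c N) + \<phi> (?g i - c N) + (real (M N) - 2) * \<phi> (?g i))"
    by (simp add: sum_spike M2)
  also have "\<dots> = (\<Sum>i<D N. \<phi> (?g i + c N)) + (\<Sum>i<D N. \<phi> (?g i - c N)) + (real (M N) - 2) * (\<Sum>i<D N. \<phi> (?g i))"
    by (simp add: sum.distrib sum_distrib_left)
  finally have S: "(\<Sum>j<D (Suc N). \<phi> (spike_code M c (Suc N) j)) = \<dots>" .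
  show "(LINT t|U. \<phi> (\<Sum>n<Suc N. c n * spike_fun M n t)) =
        (1 - 2 / real (M N)) * (LINT t|U. \<phi> (\<Sum>n<N. c n * spike_fun M n t))
        + 2 / real (M N) / 2 * (LINT t|U. \<phi> ((\<Sum>n<N. c n * spike_fun M n t) + c N))
        + 2 / real (M N) / 2 * (LINT t|U. \<phi> ((\<Sum>n<N. c n * spike_fun M n t) - c N))"
    unfolding E[of \<phi> "Suc N"] E[of \<phi> N] E[of "\<lambda>x. \<phi> (x + c N)" N] E[of "\<lambda>x. \<phi> (x - c N)" N] S
    using M[of N] D[of N] by (simp add: DS field_simps)
qed

context symmetric_spikes
begin

definition S :: "(nat \<Rightarrow> real) \<Rightarrow> nat \<Rightarrow> real \<Rightarrow> real" where
  "S c N t = (\<Sum>n<N. c n * f n t)"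

lemma S_measurable [measurable]: "S c N \<in> borel_measurable U"
  unfolding S_def by measurable

lemma S_bound: "\<bar>S c N t\<bar> \<le> (\<Sum>n<N. \<bar>c n\<bar>)"
  unfolding S_def
  by (rule order_trans[OF sum_abs]) (auto intro!: sum_mono mult_left_le simp: abs_mult f_bound)

lemma S_linear: "S (\<lambda>n. a * c n + b * d n) N t = a * S c N t + b * S d N t"
  by (simp add: S_def sum.distrib sum_distrib_left algebra_simps)

lemma integrable_continuous_S:
  assumes "continuous_on UNIV \<phi>"
  shows "integrable U (\<lambda>t. \<phi> (S c N t) :: real)"
proof -
  let ?B = "\<Sum>n<N. \<bar>c n\<bar>"
  have "compact (\<phi> ` {- ?B..?B})"
    using assms by (intro compact_continuous_image) (auto intro: continuous_on_subset)
  then obtain K where "\<forall>y \<in> \<phi> ` {- ?B..?B}. \<bar>y\<bar> \<le> K"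
    by (metis bounded_iff compact_imp_bounded real_norm_def)
  then have K: "\<bar>\<phi> x\<bar> \<le> K" if "\<bar>x\<bar> \<le> ?B" for x
    using that by (auto simp: abs_le_iff)
  have [measurable]: "\<phi> \<in> borel_measurable borel"
    using assms by (rule borel_measurable_continuous_onI)
  show ?thesis
  proof (rule U.integrable_const_bound)
    show "AE t in U. norm (\<phi> (S c N t)) \<le> K"
      using K[OF S_bound] by simp
  qed measurable
qed

lemma law_mean:
  assumes c\<phi>: "continuous_on UNIV \<phi>"
  shows "(LINT t|U. \<phi> (S c (Suc N) t)) =
    (1 - m N) * (LINT t|U. \<phi> (S c N t)) + m N * (LINT t|U. (\<phi> (S c N t + c N) + \<phi> (S c N t - c N)) / 2)"
proof -
  have "integrable U (\<lambda>t. \<phi> (S c N t + c N))" "integrable U (\<lambda>t. \<phi> (S c N t - c N))"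
    by (rule integrable_continuous_S[of "\<lambda>x. \<phi> (x + c N)"] integrable_continuous_S[of "\<lambda>x. \<phi> (x - c N)"],
      auto intro!: continuous_intros continuous_on_compose2[OF c\<phi>])+
  then show ?thesis
    using law[OF c\<phi>, of c N] by (simp add: S_def algebra_simps)
qed

lemma law_le:
  assumes c\<phi>: "continuous_on UNIV \<phi>"
    and le: "\<And>x. (\<phi> (x + c N) + \<phi> (x - c N)) / 2 \<le> A * \<phi> x + B"
  shows "(LINT t|U. \<phi> (S c (Suc N) t)) \<le> (1 + m N * (A - 1)) * (LINT t|U. \<phi> (S c N t)) + m N * B"
proof -
  have "(LINT t|U. (\<phi> (S c N t + c N) + \<phi> (S c N t - c N)) / 2) \<le> (LINT t|U. A * \<phi> (S c N t) + B)"
  proof (rule integral_mono)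
    show "integrable U (\<lambda>t. (\<phi> (S c N t + c N) + \<phi> (S c N t - c N)) / 2)"
      by (rule integrable_continuous_S[of "\<lambda>x. (\<phi> (x + c N) + \<phi> (x - c N)) / 2"])
        (auto intro!: continuous_intros continuous_on_compose2[OF c\<phi>])
    show "integrable U (\<lambda>t. A * \<phi> (S c N t) + B)"
      by (rule integrable_continuous_S[of "\<lambda>x. A * \<phi> x + B"]) (auto intro!: continuous_intros c\<phi>)
  qed (rule le)
  also have "\<dots> = A * (LINT t|U. \<phi> (S c N t)) + B"
    using integrable_continuous_S[OF c\<phi>, of c N] prob_unit_interval(2) by simp
  finally have "m N * (LINT t|U. (\<phi> (S c N t + c N) + \<phi> (S c N t - c N)) / 2)
      \<le> m N * (A * (LINT t|U. \<phi> (S c N t)) + B)"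
    using m_pos[of N] by (intro mult_left_mono) auto
  then show ?thesis
    unfolding law_mean[OF c\<phi>] by (simp add: algebra_simps)
qed

lemma second_moment_S: "(LINT t|U. (S c N t)\<^sup>2) = (\<Sum>n<N. (c n)\<^sup>2 * m n)"
proof (induction N)
  case (Suc N)
  have c2: "continuous_on UNIV (\<lambda>x::real. x\<^sup>2)" by (intro continuous_intros)
  have "((x + c N)\<^sup>2 + (x - c N)\<^sup>2) / 2 = x\<^sup>2 + (c N)\<^sup>2" for x
    by (simp add: power2_eq_square algebra_simps)
  then have "(LINT t|U. (S c (Suc N) t)\<^sup>2) =
      (1 - m N) * (LINT t|U. (S c N t)\<^sup>2) + m N * (LINT t|U. (S c N t)\<^sup>2 + (c N)\<^sup>2)"
    using law_mean[OF c2, of c N] by (simp only:)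
  also have "(LINT t|U. (S c N t)\<^sup>2 + (c N)\<^sup>2) = (LINT t|U. (S c N t)\<^sup>2) + (c N)\<^sup>2"
    using integrable_continuous_S[OF c2, of c N] prob_unit_interval(2) by simp
  finally show ?case
    using Suc.IH by (simp add: algebra_simps)
qed (simp add: S_def)

lemma moment_S_le_sum:
  assumes "1 \<le> q" "q \<le> 2"
  shows "(LINT t|U. \<bar>S c N t\<bar> powr q) \<le> (\<Sum>n<N. \<bar>c n\<bar> powr q * m n)"
proof (induction N)
  case (Suc N)
  have "(LINT t|U. \<bar>S c (Suc N) t\<bar> powr q)
      \<le> (1 + m N * (1 - 1)) * (LINT t|U. \<bar>S c N t\<bar> powr q) + m N * \<bar>c N\<bar> powr q"
    using two_point_powr_le[OF assms] assms by (intro law_le) (auto intro: continuous_on_abs_powr)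
  then show ?case using Suc.IH by (simp add: algebra_simps)
qed (simp add: S_def)

lemma cosh_moment_S: "(LINT t|U. cosh (l * S c N t)) \<le> exp (\<Sum>n<N. m n * (cosh (l * c n) - 1))"
proof (induction N)
  case (Suc N)
  let ?I = "LINT t|U. cosh (l * S c N t)"
  have "(LINT t|U. cosh (l * S c (Suc N) t))
      \<le> (1 + m N * (cosh (l * c N) - 1)) * ?I + m N * 0"
  proof (rule law_le)
    show "(cosh (l * (x + c N)) + cosh (l * (x - c N))) / 2 \<le> cosh (l * c N) * cosh (l * x) + 0" for x
      by (simp add: cosh_add cosh_diff right_diff_distrib distrib_left)
  qed (intro continuous_intros)
  also have "\<dots> \<le> exp (m N * (cosh (l * c N) - 1)) * exp (\<Sum>n<N. m n * (cosh (l * c n) - 1))"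
    using Suc.IH exp_ge_add_one_self[of "m N * (cosh (l * c N) - 1)"]
    by (auto intro!: mult_mono Bochner_Integration.integral_nonneg)
  finally show ?case by (simp add: exp_add mult.commute)
qed (simp add: S_def prob_unit_interval)

lemma moment_S_le_exp_sum:
  assumes "1 \<le> p"
  shows "(LINT t|U. \<bar>S c N t\<bar> powr p) \<le>
    2 powr (p - 1) * exp (2 powr (p - 1) * (\<Sum>n<N. if c n = 0 then 0 else m n)) * (\<Sum>n<N. \<bar>c n\<bar> powr p * m n)"
proof (induction N)
  case (Suc N)
  define k where "k = 2 powr (p - 1)"
  define s where "s = (\<Sum>n<N. if c n = 0 then 0 else m n)"
  define V where "V = (\<Sum>n<N. \<bar>c n\<bar> powr p * m n)"
  have s0: "0 \<le> s" and V0: "0 \<le> V" and k1: "1 \<le> k"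
    unfolding s_def V_def k_def using m_pos assms by (auto intro!: sum_nonneg mult_nonneg_nonneg simp: less_imp_le ge_one_powr_ge_zero)
  let ?I = "LINT t|U. \<bar>S c N t\<bar> powr p"
  have IH: "?I \<le> k * exp (k * s) * V"
    using Suc.IH by (simp add: k_def s_def V_def)
  show ?case
  proof (cases "c N = 0")
    case True
    then have "S c (Suc N) t = S c N t" for t by (simp add: S_def)
    with True Suc.IH assms show ?thesis by simp
  next
    case False
    have "(LINT t|U. \<bar>S c (Suc N) t\<bar> powr p) \<le> (1 + m N * (k - 1)) * ?I + m N * (k * \<bar>c N\<bar> powr p)"
    proof (rule law_le)
      show "(\<bar>x + c N\<bar> powr p + \<bar>x - c N\<bar> powr p) / 2 \<le> k * \<bar>x\<bar> powr p + k * \<bar>c N\<bar> powr p" for x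
        using abs_add_powr_le[OF assms, of x "c N"] abs_add_powr_le[OF assms, of x "- c N"]
        by (simp add: k_def algebra_simps)
    qed (use assms in \<open>auto intro: continuous_on_abs_powr\<close>)
    also have "\<dots> \<le> exp (k * m N) * (k * exp (k * s) * V) + k * exp (k * (s + m N)) * (\<bar>c N\<bar> powr p * m N)"
    proof (rule add_mono)
      have "1 + m N * (k - 1) \<le> exp (k * m N)"
        by (rule order_trans[OF _ exp_ge_add_one_self]) (use m_pos[of N] in \<open>simp add: algebra_simps\<close>)
      then show "(1 + m N * (k - 1)) * ?I \<le> exp (k * m N) * (k * exp (k * s) * V)"
        using IH by (intro mult_mono Bochner_Integration.integral_nonneg) auto
      have "1 \<le> exp (k * (s + m N))"
        using k1 s0 m_pos[of N] by simp
      then have "(k * \<bar>c N\<bar> powr p * m N) * 1 \<le> (k * \<bar>c N\<bar> powr p * m N) * exp (k * (s + m N))"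
        using k1 m_pos[of N] by (intro mult_left_mono) auto
      then show "m N * (k * \<bar>c N\<bar> powr p) \<le> k * exp (k * (s + m N)) * (\<bar>c N\<bar> powr p * m N)"
        by (simp add: algebra_simps)
    qed
    also have "\<dots> = k * exp (k * (s + m N)) * (V + \<bar>c N\<bar> powr p * m N)"
      by (simp add: algebra_simps exp_add)
    finally show ?thesis
      using False by (simp add: k_def s_def V_def)
  qed
qed (simp add: S_def)

end

subsection \<open>Rosenthal's inequality\<close>

lemma ln_le_half: "ln p \<le> p / 2" if "0 < p" for p :: real
proof -
  have "ln p = ln (p / 2) + ln 2"
    using that by (simp add: ln_div)
  then show ?thesis
    using ln_le_minus_one[of "p / 2"] that ln_2_less_1 by linarith
qed

lemma two_exp_le_powr: "2 * exp (p / 8) \<le> (17 / 10) powr p" if "2 \<le> p" for p :: real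
proof -
  have "(2::real) powr 1 \<le> 2 powr (p / 2)"
    using that by (intro powr_mono) auto
  then have 1: "2 \<le> (2 powr 4) powr (p / 8 :: real)"
    by (simp only: powr_powr) simp
  have "exp (p / 8) = exp 1 powr (p / 8)"
    by (simp add: powr_def)
  also have "\<dots> \<le> 3 powr (p / 8)"
    using that exp_le by (intro powr_mono2) auto
  finally have 2: "exp (p / 8) \<le> 3 powr (p / 8)" .
  have "2 * exp (p / 8) \<le> (2 powr 4) powr (p / 8) * 3 powr (p / 8)"
    using 1 2 by (intro mult_mono) auto
  also have "\<dots> = 48 powr (p / 8)"
    by (simp flip: powr_mult)
  also have "\<dots> \<le> ((17 / 10) powr 8) powr (p / 8)"
    using that by (intro powr_mono2) (auto simp: power_divide)
  also have "\<dots> = (17 / 10) powr p"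
    by (simp only: powr_powr) simp
  finally show ?thesis .
qed

context symmetric_spikes
begin

lemma rosenthal_unit:
  assumes p: "2 < p"
    and cp: "(\<Sum>n<N. \<bar>c n\<bar> powr p * m n) \<le> 1"
    and c2: "(\<Sum>n<N. (c n)\<^sup>2 * m n) \<le> 1"
  shows "(LINT t|U. \<bar>S c N t\<bar> powr p) \<le> (7.35 * (p / ln p)) powr p"
proof -
  define cs where "cs n = (if \<bar>c n\<bar> \<le> 2 then c n else 0)" for n
  define cb where "cb n = (if \<bar>c n\<bar> \<le> 2 then 0 else c n)" for n
  define l where "l = ln p / 2"
  define r where "r = p / ln p"
  have lnp: "0 < ln p" and l0: "0 < l" using p by (auto simp: l_def)
  have r2: "2 \<le> r" using ln_le_half[of p] p lnp by (simp add: r_def field_simps)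
  have split: "S c N t = S cs N t + S cb N t" for t
    unfolding S_def sum.distrib[symmetric] by (intro sum.cong) (auto simp: cs_def cb_def)
  have int: "integrable U (\<lambda>t. \<bar>S d N t\<bar> powr p)" for d
    using p by (intro integrable_continuous_S[of "\<lambda>x. \<bar>x\<bar> powr p"] continuous_on_abs_powr) auto
  have big: "(LINT t|U. \<bar>S cb N t\<bar> powr p) \<le> 2 powr p"
  proof -
    have "(\<Sum>n<N. if cb n = 0 then 0 else m n) \<le> (\<Sum>n<N. 2 powr (- p) * (\<bar>c n\<bar> powr p * m n))"
    proof (rule sum_mono)
      fix n
      have "2 powr p \<le> \<bar>c n\<bar> powr p" if "cb n \<noteq> 0"
        using that p by (intro powr_mono2) (auto simp: cb_def split: if_splits)
      then have "m n \<le> 2 powr (- p) * (\<bar>c n\<bar> powr p * m n)" if "cb n \<noteq> 0"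
        using that m_pos[of n] by (simp add: powr_minus field_simps)
      then show "(if cb n = 0 then 0 else m n) \<le> 2 powr (- p) * (\<bar>c n\<bar> powr p * m n)"
        using m_pos[of n] by auto
    qed
    also have "\<dots> \<le> 2 powr (- p)"
      using cp by (simp flip: sum_distrib_left)
    finally have "2 powr (p - 1) * (\<Sum>n<N. if cb n = 0 then 0 else m n) \<le> 2 powr (p - 1) * 2 powr (- p)"
      by (intro mult_left_mono) auto
    also have "\<dots> = 1 / 2"
      by (simp add: powr_minus powr_diff field_simps)
    also have "\<dots> \<le> ln 2"
      using ln2_ge_two_thirds by simp
    finally have "exp (2 powr (p - 1) * (\<Sum>n<N. if cb n = 0 then 0 else m n)) \<le> 2"
      by (metis exp_le_cancel_iff exp_ln zero_less_numeral)
    moreover have "(\<Sum>n<N. \<bar>cb n\<bar> powr p * m n) \<le> 1"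
      by (rule order_trans[OF sum_mono cp]) (use m_pos in \<open>auto simp: cb_def less_imp_le\<close>)
    ultimately have *: "2 powr (p - 1) * exp (2 powr (p - 1) * (\<Sum>n<N. if cb n = 0 then 0 else m n))
        * (\<Sum>n<N. \<bar>cb n\<bar> powr p * m n) \<le> 2 powr (p - 1) * 2 * 1"
      using m_pos by (intro mult_mono sum_nonneg) (auto simp: less_imp_le)
    show ?thesis
      by (rule order_trans[OF moment_S_le_exp_sum order_trans[OF *]]) (use p in \<open>auto simp: powr_diff\<close>)
  qed
  have small: "(LINT t|U. \<bar>S cs N t\<bar> powr p) \<le> (3.4 * r) powr p"
  proof -
    have coshp: "cosh (2 * l) - 1 \<le> p / 2"
      using p by (simp add: l_def cosh_ln_real field_simps)
    have "(\<Sum>n<N. m n * (cosh (l * cs n) - 1)) \<le> (\<Sum>n<N. p / 8 * ((c n)\<^sup>2 * m n))"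
    proof (rule sum_mono)
      fix n
      have "cosh (l * cs n) - 1 = cosh ((cs n / 2) * (2 * l)) - 1"
        by (simp add: mult.commute)
      also have "\<dots> \<le> (cs n / 2)\<^sup>2 * (cosh (2 * l) - 1)"
        by (rule cosh_mult_le) (auto simp: cs_def)
      also have "\<dots> \<le> (cs n / 2)\<^sup>2 * (p / 2)"
        using coshp by (intro mult_left_mono) auto
      also have "\<dots> \<le> p / 8 * (c n)\<^sup>2"
        using p by (auto simp: cs_def power_divide)
      finally show "m n * (cosh (l * cs n) - 1) \<le> p / 8 * ((c n)\<^sup>2 * m n)"
        using m_pos[of n] by (simp add: mult.commute mult.left_commute)
    qed
    also have "\<dots> \<le> p / 8"
      using c2 p by (subst sum_distrib_left[symmetric]) (simp add: mult_left_le)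
    finally have "(LINT t|U. cosh (l * S cs N t)) \<le> exp (p / 8)"
      by (intro order_trans[OF cosh_moment_S]) simp
    moreover have "(LINT t|U. \<bar>S cs N t\<bar> powr p) \<le> (LINT t|U. 2 * (p / l) powr p * cosh (l * S cs N t))"
      using l0 p by (intro integral_mono int abs_powr_le_cosh
        integrable_continuous_S[of "\<lambda>x. 2 * (p / l) powr p * cosh (l * x)"]) (auto intro!: continuous_intros)
    moreover have "(LINT t|U. 2 * (p / l) powr p * cosh (l * S cs N t))
        = 2 * (p / l) powr p * (LINT t|U. cosh (l * S cs N t))"
      by (rule Bochner_Integration.integral_mult_right_zero)
    moreover have "2 * (p / l) powr p * (LINT t|U. cosh (l * S cs N t)) \<le> 2 * (p / l) powr p * exp (p / 8)"
      using calculation(1) by (intro mult_left_mono) auto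
    ultimately have "(LINT t|U. \<bar>S cs N t\<bar> powr p) \<le> (p / l) powr p * (2 * exp (p / 8))"
      by linarith
    also have "\<dots> \<le> (2 * r) powr p * (17 / 10) powr p"
      using two_exp_le_powr[of p] p by (intro mult_mono) (auto simp: l_def r_def mult.commute)
    also have "\<dots> = (3.4 * r) powr p"
      using r2 by (simp flip: powr_mult)
    finally show ?thesis .
  qed
  have "(LINT t|U. \<bar>S c N t\<bar> powr p)
      \<le> (LINT t|U. 2 powr (p - 1) * (\<bar>S cs N t\<bar> powr p + \<bar>S cb N t\<bar> powr p))"
  proof (intro integral_mono int integrable_mult_right Bochner_Integration.integrable_add)
    show "\<bar>S c N t\<bar> powr p \<le> 2 powr (p - 1) * (\<bar>S cs N t\<bar> powr p + \<bar>S cb N t\<bar> powr p)" for t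
      unfolding split[of t] using p by (intro abs_add_powr_le) simp
  qed
  also have "\<dots> = 2 powr (p - 1) * ((LINT t|U. \<bar>S cs N t\<bar> powr p) + (LINT t|U. \<bar>S cb N t\<bar> powr p))"
    using int by simp
  also have "\<dots> \<le> 2 powr (p - 1) * ((3.4 * r) powr p + (3.4 * r) powr p)"
    using small r2 p
    by (intro mult_left_mono add_mono order_trans[OF big] powr_mono2 small) auto
  also have "\<dots> = 2 powr p * (3.4 * r) powr p"
    by (simp add: powr_diff)
  also have "\<dots> = (6.8 * r) powr p"
    using r2 by (simp flip: powr_mult)
  also have "\<dots> \<le> (7.35 * r) powr p"
    using r2 p by (intro powr_mono2) auto
  finally show ?thesis by (simp add: r_def)
qed

theorem rosenthal:
  assumes p: "2 < p" and R: "0 \<le> R"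
    and cp: "(\<Sum>n<N. \<bar>c n\<bar> powr p * m n) \<le> R powr p"
    and c2: "(\<Sum>n<N. (c n)\<^sup>2 * m n) \<le> R\<^sup>2"
  shows "(LINT t|U. \<bar>S c N t\<bar> powr p) \<le> (7.35 * (p / ln p) * R) powr p"
proof (cases "R = 0")
  case True
  have "(\<Sum>n<N. (c n)\<^sup>2 * m n) = 0"
    using c2 True m_pos by (intro antisym sum_nonneg) (auto simp: less_imp_le)
  then have "\<forall>n\<in>{..<N}. (c n)\<^sup>2 * m n = 0"
    using m_pos by (subst (asm) sum_nonneg_eq_0_iff) (auto simp: less_imp_le)
  then have "S c N t = 0" for t
    using m_pos unfolding S_def by (intro sum.neutral) (auto simp: less_le)
  then show ?thesis using p by simp
next
  case False
  with R have R: "0 < R" by simp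
  have eq: "S (\<lambda>n. c n / R) N t = S c N t / R" for t
    by (simp add: S_def sum_divide_distrib)
  have "(LINT t|U. \<bar>S (\<lambda>n. c n / R) N t\<bar> powr p) \<le> (7.35 * (p / ln p)) powr p"
  proof (rule rosenthal_unit[OF p])
    have "(\<Sum>n<N. \<bar>c n / R\<bar> powr p * m n) = (\<Sum>n<N. \<bar>c n\<bar> powr p * m n) / R powr p"
      using R by (simp add: sum_divide_distrib powr_divide)
    then show "(\<Sum>n<N. \<bar>c n / R\<bar> powr p * m n) \<le> 1"
      using cp R by simp
    have "(\<Sum>n<N. (c n / R)\<^sup>2 * m n) = (\<Sum>n<N. (c n)\<^sup>2 * m n) / R\<^sup>2"
      using R by (simp add: sum_divide_distrib power_divide)
    then show "(\<Sum>n<N. (c n / R)\<^sup>2 * m n) \<le> 1"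
      using c2 R by simp
  qed
  also have "(LINT t|U. \<bar>S (\<lambda>n. c n / R) N t\<bar> powr p) = (LINT t|U. \<bar>S c N t\<bar> powr p) / R powr p"
    using R by (simp add: eq powr_divide)
  finally have "(LINT t|U. \<bar>S c N t\<bar> powr p) \<le> (7.35 * (p / ln p)) powr p * R powr p"
    using R by (simp add: pos_divide_le_eq)
  also have "\<dots> = (7.35 * (p / ln p) * R) powr p"
    by (rule powr_mult[symmetric])
  finally show ?thesis .
qed

end

subsection \<open>\<open>L\<^sub>2\<close> and \<open>L\<^sub>p\<close> on the unit interval\<close>

lemma memLq_2_iff: "memLq 2 f \<longleftrightarrow> f \<in> borel_measurable U \<and> integrable U (\<lambda>t. (f t)\<^sup>2)"
proof -
  have "\<bar>x\<bar> powr 2 = x\<^sup>2" for x :: real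
    by (cases "x = 0") (simp_all add: powr_numeral)
  then show ?thesis by (simp add: memLq_def)
qed

lemma integrable_mult_L2:
  assumes "memLq 2 f" "memLq 2 g"
  shows "integrable U (\<lambda>t. f t * g t)"
proof (rule Bochner_Integration.integrable_bound)
  show "integrable U (\<lambda>t. (f t)\<^sup>2 + (g t)\<^sup>2)"
    using assms by (auto simp: memLq_2_iff)
  have "\<bar>x * y\<bar> \<le> x\<^sup>2 + y\<^sup>2" for x y :: real
  proof -
    have "0 \<le> (\<bar>x\<bar> - \<bar>y\<bar>)\<^sup>2" by simp
    then have "2 * \<bar>x * y\<bar> \<le> x\<^sup>2 + y\<^sup>2"
      by (simp add: power2_diff abs_mult)
    then show ?thesis by linarith
  qed
  then show "AE t in U. norm (f t * g t) \<le> norm ((f t)\<^sup>2 + (g t)\<^sup>2)"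
    by simp
qed (use assms in \<open>auto simp: memLq_2_iff\<close>)

lemma memLq_2_linear:
  assumes f: "memLq 2 f" and g: "memLq 2 g"
  shows "memLq 2 (\<lambda>t. a * f t + b * g t)"
proof -
  have "(a * x + b * y)\<^sup>2 = a\<^sup>2 * x\<^sup>2 + 2 * a * b * (x * y) + b\<^sup>2 * y\<^sup>2" for x y
    by (simp add: power2_eq_square algebra_simps)
  moreover have "integrable U (\<lambda>t. a\<^sup>2 * (f t)\<^sup>2 + 2 * a * b * (f t * g t) + b\<^sup>2 * (g t)\<^sup>2)"
    using f g integrable_mult_L2[OF f g] by (auto simp: memLq_2_iff)
  ultimately show ?thesis
    using f g by (auto simp: memLq_2_iff)
qed

lemma memLq_2_diff: "memLq 2 f \<Longrightarrow> memLq 2 g \<Longrightarrow> memLq 2 (\<lambda>t. f t - g t)"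
  using memLq_2_linear[of f g 1 "-1"] by simp

lemma memLq_2_bounded:
  assumes "f \<in> borel_measurable U" "\<And>t. \<bar>f t\<bar> \<le> B"
  shows "memLq 2 f"
proof -
  have "integrable U (\<lambda>t. (f t)\<^sup>2)"
  proof (rule U.integrable_const_bound)
    have "(f t)\<^sup>2 \<le> B\<^sup>2" for t
      using power_mono[OF assms(2), of t 2] by simp
    then show "AE t in U. norm ((f t)\<^sup>2) \<le> B\<^sup>2" by simp
  qed (use assms in measurable)
  with assms show ?thesis by (simp add: memLq_2_iff)
qed

lemma Cauchy_Schwarz_L2:
  assumes f: "memLq 2 f" and g: "memLq 2 g"
  shows "(LINT t|U. f t * g t)\<^sup>2 \<le> (LINT t|U. (f t)\<^sup>2) * (LINT t|U. (g t)\<^sup>2)"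
proof -
  define A B C where "A = (LINT t|U. (f t)\<^sup>2)" and "B = (LINT t|U. f t * g t)" and "C = (LINT t|U. (g t)\<^sup>2)"
  have quad: "0 \<le> A + 2 * s * B + s\<^sup>2 * C" for s
  proof -
    have "0 \<le> (LINT t|U. (f t + s * g t)\<^sup>2)"
      by (intro Bochner_Integration.integral_nonneg) simp
    also have "\<dots> = (LINT t|U. (f t)\<^sup>2 + 2 * s * (f t * g t) + s\<^sup>2 * (g t)\<^sup>2)"
      by (intro Bochner_Integration.integral_cong) (auto simp: power2_eq_square algebra_simps)
    also have "\<dots> = A + 2 * s * B + s\<^sup>2 * C"
      unfolding A_def B_def C_def using f g integrable_mult_L2[OF f g] by (simp add: memLq_2_iff)
    finally show ?thesis .
  qed
  have "0 \<le> C" unfolding C_def by (intro Bochner_Integration.integral_nonneg) simp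
  have "B\<^sup>2 \<le> A * C"
  proof (cases "C = 0")
    case True
    have "B = 0"
    proof (rule ccontr)
      assume "B \<noteq> 0"
      then show False using quad[of "- (A + 1) / (2 * B)"] True by (auto simp: field_simps)
    qed
    with True show ?thesis by simp
  next
    case False
    have "0 \<le> A + 2 * (- B / C) * B + (- B / C)\<^sup>2 * C" by (rule quad)
    also have "\<dots> = A - B\<^sup>2 / C"
      using False by (simp add: power2_eq_square field_simps)
    finally show ?thesis
      using False \<open>0 \<le> C\<close> by (simp add: field_simps)
  qed
  then show ?thesis by (simp add: A_def B_def C_def)
qed

lemma tendsto_integral_mult_L2:
  assumes u: "\<And>n. memLq 2 (u n)" and h: "memLq 2 h"
    and lim: "(\<lambda>n. LINT t|U. (u n t)\<^sup>2) \<longlonglongrightarrow> 0"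
  shows "(\<lambda>n. LINT t|U. u n t * h t) \<longlonglongrightarrow> 0"
proof -
  have "(\<lambda>n. (LINT t|U. u n t * h t)\<^sup>2) \<longlonglongrightarrow> 0"
  proof (rule tendsto_sandwich[where f = "\<lambda>_. 0"])
    show "(\<lambda>n. (LINT t|U. (u n t)\<^sup>2) * (LINT t|U. (h t)\<^sup>2)) \<longlonglongrightarrow> 0"
      using tendsto_mult_right[OF lim] by simp
  qed (auto intro!: always_eventually Cauchy_Schwarz_L2 u h)
  from tendsto_real_sqrt[OF this] show ?thesis
    by (simp add: tendsto_rabs_zero_iff)
qed

text \<open>With \<open>\<integral>\<bar>f\<bar>\<^sup>p = A\<close>, Young's inequality for \<open>(f / A\<^bsup>1/p\<^esup>)\<^sup>2 \<cdot> 1\<close> with exponents \<open>p/2\<close> and \<open>p/(p-2)\<close>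
  integrates to the norm inequality.\<close>

lemma memLq_imp_L2:
  assumes p: "2 < p" and f: "memLq p f"
  shows "memLq 2 f" and "(LINT t|U. (f t)\<^sup>2) \<le> (normLq p f)\<^sup>2"
proof -
  have young: "x\<^sup>2 \<le> 2 / p * \<bar>x\<bar> powr p + (1 - 2 / p)" for x :: real
  proof -
    have sq: "(x\<^sup>2) powr (p / 2) = \<bar>x\<bar> powr p"
    proof -
      have *: "x\<^sup>2 = \<bar>x\<bar> powr 2"
        by (cases "x = 0") (simp_all add: powr_numeral)
      show ?thesis unfolding * powr_powr using p by simp
    qed
    have "x\<^sup>2 * 1 \<le> (x\<^sup>2) powr (p / 2) / (p / 2) + 1 powr (p / (p - 2)) / (p / (p - 2))"
      using p by (intro Youngs_inequality) (auto simp: field_simps)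
    then show ?thesis using p by (simp add: sq field_simps)
  qed
  have [measurable]: "f \<in> borel_measurable U" using f by (simp add: memLq_def)
  have fp: "integrable U (\<lambda>t. \<bar>f t\<bar> powr p)" using f by (simp add: memLq_def)
  have f2: "integrable U (\<lambda>t. (f t)\<^sup>2)"
  proof (rule Bochner_Integration.integrable_bound)
    show "integrable U (\<lambda>t. 2 / p * \<bar>f t\<bar> powr p + (1 - 2 / p))"
      using fp by simp
    show "AE t in U. norm ((f t)\<^sup>2) \<le> norm (2 / p * \<bar>f t\<bar> powr p + (1 - 2 / p))"
    proof (intro AE_I2)
      fix t
      have "norm ((f t)\<^sup>2) = (f t)\<^sup>2" by simp
      also have "\<dots> \<le> norm (2 / p * \<bar>f t\<bar> powr p + (1 - 2 / p))"
        using young[of "f t"] by (simp only: real_norm_def)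
      finally show "norm ((f t)\<^sup>2) \<le> norm (2 / p * \<bar>f t\<bar> powr p + (1 - 2 / p))" .
    qed
  qed measurable
  then show "memLq 2 f" by (simp add: memLq_2_iff)
  define A where "A = (LINT t|U. \<bar>f t\<bar> powr p)"
  have "0 \<le> A" unfolding A_def by (intro Bochner_Integration.integral_nonneg) simp
  show "(LINT t|U. (f t)\<^sup>2) \<le> (normLq p f)\<^sup>2"
  proof (cases "A = 0")
    case True
    then have "AE t in U. \<bar>f t\<bar> powr p = 0"
      unfolding A_def using fp by (subst (asm) integral_nonneg_eq_0_iff_AE) auto
    then have "AE t in U. (f t)\<^sup>2 = 0" by eventually_elim simp
    then have "(LINT t|U. (f t)\<^sup>2) = 0" by (rule integral_eq_zero_AE)
    then show ?thesis by simp
  next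
    case False
    define a where "a = normLq p f"
    have a: "0 < a" "a powr p = A"
      using False \<open>0 \<le> A\<close> p by (simp_all add: a_def normLq_def A_def[symmetric] powr_powr)
    have "(LINT t|U. (f t / a)\<^sup>2) \<le> (LINT t|U. 2 / p * \<bar>f t / a\<bar> powr p + (1 - 2 / p))"
      using f2 fp a by (intro integral_mono young) (auto simp: power_divide powr_divide)
    also have "\<dots> = 2 / p * (A / a powr p) + (1 - 2 / p)"
      using fp a prob_unit_interval(2) by (simp add: powr_divide A_def)
    also have "\<dots> = 1" using a False by simp
    finally have "(LINT t|U. (f t)\<^sup>2) / a\<^sup>2 \<le> 1"
      by (simp add: power_divide)
    then show ?thesis using a by (simp add: a_def)
  qed
qed

lemma fatou_integral_le:
  fixes u :: "nat \<Rightarrow> real \<Rightarrow> real"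
  assumes int: "\<And>k. integrable U (u k)" and nonneg: "\<And>k t. 0 \<le> u k t"
    and v: "v \<in> borel_measurable U" and lim: "AE t in U. (\<lambda>k. u k t) \<longlonglongrightarrow> v t"
    and le: "\<And>k. (LINT t|U. u k t) \<le> B"
  shows "integrable U v" and "(LINT t|U. v t) \<le> B"
proof -
  have B: "0 \<le> B"
    by (rule order_trans[OF _ le[of 0]]) (simp add: nonneg)
  have nn: "AE t in U. 0 \<le> v t"
    using lim by eventually_elim (auto intro: LIMSEQ_le_const nonneg)
  have "(\<integral>\<^sup>+t. ennreal (v t) \<partial>U) = (\<integral>\<^sup>+t. liminf (\<lambda>k. ennreal (u k t)) \<partial>U)"
    using lim by (intro nn_integral_cong_AE, eventually_elim)
      (auto intro!: lim_imp_Liminf[symmetric] tendsto_ennrealI)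
  also have "\<dots> \<le> liminf (\<lambda>k. \<integral>\<^sup>+t. ennreal (u k t) \<partial>U)"
    using int by (intro nn_integral_liminf) auto
  also have "\<dots> \<le> ennreal B"
    using le int nonneg by (intro Liminf_le) (auto simp: nn_integral_eq_integral ennreal_leI)
  finally have *: "(\<integral>\<^sup>+t. ennreal (v t) \<partial>U) \<le> ennreal B" .
  then show "integrable U v"
    using v nn by (intro integrableI_nonneg) (auto intro: le_less_trans)
  then show "(LINT t|U. v t) \<le> B"
    using * B nn by (simp add: nn_integral_eq_integral)
qed

lemma riesz_fischer_L2:
  fixes s :: "nat \<Rightarrow> real \<Rightarrow> real"
  assumes s: "\<And>n. memLq 2 (s n)"
    and cauchy: "\<And>e. 0 < e \<Longrightarrow> \<exists>N. \<forall>i\<ge>N. \<forall>j\<ge>N. (LINT t|U. (s i t - s j t)\<^sup>2) < e"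
  obtains g r where "memLq 2 g" "strict_mono r" "AE t in U. (\<lambda>k. s (r k) t) \<longlonglongrightarrow> g t"
    "(\<lambda>n. LINT t|U. (s n t - g t)\<^sup>2) \<longlonglongrightarrow> 0"
proof -
  have [measurable]: "s n \<in> borel_measurable U" for n using s by (simp add: memLq_def)
  have "\<forall>k. \<exists>N. \<forall>i\<ge>N. \<forall>j\<ge>N. (LINT t|U. (s i t - s j t)\<^sup>2) < (1 / 4) ^ k"
    by (intro allI cauchy) simp
  then obtain Nf where Nf: "\<And>k i j. i \<ge> Nf k \<Longrightarrow> j \<ge> Nf k \<Longrightarrow> (LINT t|U. (s i t - s j t)\<^sup>2) < (1 / 4) ^ k"
    by metis
  define r where "r k = (\<Sum>i\<le>k. Suc (Nf i))" for k
  have r: "strict_mono r" by (simp add: strict_mono_Suc_iff r_def)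
  have rN: "Nf k \<le> r k" for k
    by (cases k) (simp_all add: r_def)
  define d where "d k t = s (r (Suc k)) t - s (r k) t" for k t
  have d2: "memLq 2 (d k)" for k unfolding d_def by (intro memLq_2_diff s)
  have dle: "(LINT t|U. \<bar>d k t\<bar>) \<le> (1 / 2) ^ k" and dint: "integrable U (\<lambda>t. \<bar>d k t\<bar>)" for k
  proof -
    have ad: "memLq 2 (\<lambda>t. \<bar>d k t\<bar>)"
      using d2[of k] by (auto simp: memLq_2_iff)
    have one: "memLq 2 (\<lambda>t. 1)"
      by (rule memLq_2_bounded[of _ 1]) auto
    show "integrable U (\<lambda>t. \<bar>d k t\<bar>)"
      using integrable_mult_L2[OF ad one] by simp
    have "(LINT t|U. \<bar>d k t\<bar>)\<^sup>2 \<le> (LINT t|U. (d k t)\<^sup>2)"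
      using Cauchy_Schwarz_L2[OF ad one] prob_unit_interval(2) by simp
    also have "\<dots> \<le> (1 / 4) ^ k"
      unfolding d_def using rN[of k] strict_monoD[OF r, of k "Suc k"]
      by (intro less_imp_le[OF Nf]) auto
    also have "(1 / 4 :: real) ^ k = ((1 / 2) ^ k)\<^sup>2"
      by (simp add: power_mult[symmetric] power2_eq_square power_mult_distrib[symmetric])
    finally show "(LINT t|U. \<bar>d k t\<bar>) \<le> (1 / 2) ^ k"
      by (rule power2_le_imp_le) simp
  qed
  have [measurable]: "d k \<in> borel_measurable U" for k unfolding d_def by measurable
  have "(\<integral>\<^sup>+t. (\<Sum>k. ennreal \<bar>d k t\<bar>) \<partial>U) = (\<Sum>k. \<integral>\<^sup>+t. ennreal \<bar>d k t\<bar> \<partial>U)"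
    by (intro nn_integral_suminf) measurable
  also have "\<dots> \<le> (\<Sum>k. ennreal ((1 / 2) ^ k))"
    using dle dint by (intro suminf_le) (auto simp: nn_integral_eq_integral ennreal_leI)
  also have "\<dots> < \<infinity>"
    by (subst suminf_ennreal2) (auto intro: summable_geometric)
  finally have "AE t in U. (\<Sum>k. ennreal \<bar>d k t\<bar>) \<noteq> \<infinity>"
    by (intro nn_integral_PInf_AE) auto
  then have summ: "AE t in U. summable (\<lambda>k. d k t)"
  proof eventually_elim
    case (elim t)
    then have "summable (\<lambda>k. \<bar>d k t\<bar>)"
      by (intro summable_suminf_not_top) auto
    then show ?case by (rule summable_rabs_cancel)
  qed
  define g where "g t = s (r 0) t + (\<Sum>k. d k t)" for t
  have [measurable]: "g \<in> borel_measurable U"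
    unfolding g_def by measurable
  have lim: "AE t in U. (\<lambda>k. s (r k) t) \<longlonglongrightarrow> g t"
    using summ
  proof eventually_elim
    case (elim t)
    have "s (r 0) t + (\<Sum>i<k. d i t) = s (r k) t" for k
      by (induction k) (auto simp: d_def)
    moreover have "(\<lambda>k. s (r 0) t + (\<Sum>i<k. d i t)) \<longlonglongrightarrow> g t"
      unfolding g_def by (intro tendsto_intros summable_LIMSEQ elim)
    ultimately show ?case by simp
  qed
  have near: "integrable U (\<lambda>t. (s n t - g t)\<^sup>2) \<and> (LINT t|U. (s n t - g t)\<^sup>2) \<le> e"
    if N: "\<forall>i\<ge>N. \<forall>j\<ge>N. (LINT t|U. (s i t - s j t)\<^sup>2) < e" and n: "n \<ge> N" for e N n
  proof -
    have rk: "N \<le> r (k + N)" for k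
      using seq_suble[OF r, of "k + N"] by simp
    have int: "integrable U (\<lambda>t. (s n t - s (r (k + N)) t)\<^sup>2)" for k
      using memLq_2_diff[OF s s] by (simp add: memLq_2_iff)
    have lim2: "AE t in U. (\<lambda>k. (s n t - s (r (k + N)) t)\<^sup>2) \<longlonglongrightarrow> (s n t - g t)\<^sup>2"
      using lim
    proof eventually_elim
      case (elim t)
      show ?case
        by (intro tendsto_intros LIMSEQ_ignore_initial_segment[OF elim])
    qed
    have le: "(LINT t|U. (s n t - s (r (k + N)) t)\<^sup>2) \<le> e" for k
      using N n rk by (intro less_imp_le) blast
    have meas: "(\<lambda>t. (s n t - g t)\<^sup>2) \<in> borel_measurable U" by measurable
    show ?thesis
      using fatou_integral_le[OF int zero_le_power2 meas lim2 le] by blast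
  qed
  have "memLq 2 g"
  proof -
    obtain N where "\<forall>i\<ge>N. \<forall>j\<ge>N. (LINT t|U. (s i t - s j t)\<^sup>2) < 1"
      using cauchy[of 1] by auto
    from near[OF this order_refl] have "memLq 2 (\<lambda>t. s N t - g t)"
      by (simp add: memLq_2_iff)
    from memLq_2_diff[OF s[of N] this] show ?thesis by simp
  qed
  moreover have "(\<lambda>n. LINT t|U. (s n t - g t)\<^sup>2) \<longlonglongrightarrow> 0"
  proof (rule LIMSEQ_I)
    fix e :: real assume "0 < e"
    then obtain N where N: "\<forall>i\<ge>N. \<forall>j\<ge>N. (LINT t|U. (s i t - s j t)\<^sup>2) < e / 2"
      using cauchy[of "e / 2"] by auto
    have "norm ((LINT t|U. (s n t - g t)\<^sup>2) - 0) < e" if "n \<ge> N" for n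
    proof -
      have "0 \<le> (LINT t|U. (s n t - g t)\<^sup>2)" by simp
      moreover have "(LINT t|U. (s n t - g t)\<^sup>2) \<le> e / 2" using near[OF N that] by blast
      ultimately show ?thesis using \<open>0 < e\<close> by simp
    qed
    then show "\<exists>N. \<forall>n\<ge>N. norm ((LINT t|U. (s n t - g t)\<^sup>2) - 0) < e" by blast
  qed
  ultimately show ?thesis using that r lim by blast
qed

lemma memLq_diff:
  assumes p: "1 \<le> p" and f: "memLq p f" and g: "memLq p g"
  shows "memLq p (\<lambda>t. f t - g t)"
proof -
  have [measurable]: "f \<in> borel_measurable U" "g \<in> borel_measurable U"
    using f g by (simp_all add: memLq_def)
  have "integrable U (\<lambda>t. \<bar>f t - g t\<bar> powr p)"
  proof (rule Bochner_Integration.integrable_bound)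
    show "integrable U (\<lambda>t. 2 powr (p - 1) * (\<bar>f t\<bar> powr p + \<bar>g t\<bar> powr p))"
      using f g by (simp add: memLq_def)
    show "AE t in U. norm (\<bar>f t - g t\<bar> powr p) \<le> norm (2 powr (p - 1) * (\<bar>f t\<bar> powr p + \<bar>g t\<bar> powr p))"
      using abs_add_powr_le[OF p, of "f t" "- g t" for t] by simp
  qed measurable
  then show ?thesis by (simp add: memLq_def)
qed

lemma sum_lessThan_split:
  fixes h :: "nat \<Rightarrow> real"
  assumes "j \<le> i"
  shows "sum h {..<i} = sum h {..<j} + sum h {j..<i}"
  using sum.atLeastLessThan_concat[OF _ assms, of 0 h] by (simp add: atLeast0LessThan)

lemma normLq_nonneg: "0 \<le> normLq q f"
  by (simp add: normLq_def)

lemma normLq_powr: "0 < q \<Longrightarrow> normLq q f powr q = (LINT t|U. \<bar>f t\<bar> powr q)"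
  by (simp add: normLq_def powr_powr)

lemma L2_dist_commute: "(LINT t|U. (x t - y t :: real)\<^sup>2) = (LINT t|U. (y t - x t)\<^sup>2)"
  by (intro Bochner_Integration.integral_cong refl) (rule power2_commute)

lemma L2_triangle:
  assumes x: "memLq 2 x" and y: "memLq 2 y" and z: "memLq 2 z"
  shows "(LINT t|U. (x t - z t)\<^sup>2) \<le> 2 * (LINT t|U. (x t - y t)\<^sup>2) + 2 * (LINT t|U. (y t - z t)\<^sup>2)"
proof -
  have int: "integrable U (\<lambda>t. (x t - z t)\<^sup>2)" "integrable U (\<lambda>t. (x t - y t)\<^sup>2)" "integrable U (\<lambda>t. (y t - z t)\<^sup>2)"
    using memLq_2_diff[OF x z] memLq_2_diff[OF x y] memLq_2_diff[OF y z] by (simp_all add: memLq_2_iff)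
  have "(a - c)\<^sup>2 \<le> 2 * (a - b)\<^sup>2 + 2 * (b - c)\<^sup>2" for a b c :: real
  proof -
    have "0 \<le> ((a - b) - (b - c))\<^sup>2" by simp
    then show ?thesis by (simp add: power2_eq_square algebra_simps)
  qed
  then have "(LINT t|U. (x t - z t)\<^sup>2) \<le> (LINT t|U. 2 * (x t - y t)\<^sup>2 + 2 * (y t - z t)\<^sup>2)"
    using int by (intro integral_mono) auto
  then show ?thesis using int by simp
qed

lemma ae_eq_refl: "ae_eq g g"
  by (simp add: ae_eq_def)

lemma ae_eq_if_L2_dist_0:
  assumes x: "memLq 2 x" and y: "memLq 2 y" and le: "(LINT t|U. (x t - y t)\<^sup>2) \<le> 0"
  shows "ae_eq x y"
proof -
  have "integrable U (\<lambda>t. (x t - y t)\<^sup>2)"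
    using memLq_2_diff[OF x y] by (simp add: memLq_2_iff)
  moreover have "(LINT t|U. (x t - y t)\<^sup>2) = 0"
    using le by (intro antisym) auto
  ultimately have "AE t in U. (x t - y t)\<^sup>2 = 0"
    by (subst (asm) integral_nonneg_eq_0_iff_AE) auto
  then show ?thesis unfolding ae_eq_def by eventually_elim simp
qed

subsection \<open>The orthogonal projection onto the span\<close>

context symmetric_spikes
begin

definition coef :: "(real \<Rightarrow> real) \<Rightarrow> nat \<Rightarrow> real" where
  "coef g n = (LINT t|U. g t * f n t) / m n"

lemma f_L2: "memLq 2 (f n)"
  by (rule memLq_2_bounded[OF f_measurable f_bound])

lemma S_L2: "memLq 2 (S c N)"
  by (rule memLq_2_bounded[OF S_measurable S_bound])

lemma inner_S:
  assumes "memLq 2 g"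
  shows "(LINT t|U. g t * S c N t) = (\<Sum>n<N. c n * coef g n * m n)"
proof -
  have "(LINT t|U. g t * S c N t) = (LINT t|U. (\<Sum>n<N. c n * (g t * f n t)))"
    by (simp add: S_def sum_distrib_left mult.left_commute)
  also have "\<dots> = (\<Sum>n<N. c n * (LINT t|U. g t * f n t))"
    using integrable_mult_L2[OF assms f_L2] by (subst Bochner_Integration.integral_sum) auto
  also have "\<dots> = (\<Sum>n<N. c n * coef g n * m n)"
    using m_pos by (intro sum.cong) (auto simp: coef_def less_imp_neq[symmetric])
  finally show ?thesis .
qed

lemma coef_S:
  assumes "n < N"
  shows "(LINT t|U. S c N t * f n t) = c n * m n"
proof -
  define d where "d k = (if k = n then 1 else 0 :: real)" for k
  have Sd: "S d N t = f n t" for t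
    using assms by (simp add: S_def d_def if_distrib[of "\<lambda>x. x * _"] sum.delta' cong: if_cong)
  have int: "integrable U (\<lambda>t. (S e N t)\<^sup>2)" for e
    using S_L2 by (simp add: memLq_2_iff)
  have "S c N t * f n t = ((S (\<lambda>k. 1 * c k + 1 * d k) N t)\<^sup>2 - (S (\<lambda>k. 1 * c k + (- 1) * d k) N t)\<^sup>2) / 4" for t
    unfolding S_linear Sd by (simp add: power2_eq_square algebra_simps)
  then have "(LINT t|U. S c N t * f n t)
      = ((\<Sum>k<N. (1 * c k + 1 * d k)\<^sup>2 * m k) - (\<Sum>k<N. (1 * c k + (- 1) * d k)\<^sup>2 * m k)) / 4"
    using int by (simp only: second_moment_S[symmetric]) simp
  also have "\<dots> = (\<Sum>k<N. c k * d k * m k)"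
    unfolding sum_subtractf[symmetric] sum_divide_distrib
    by (intro sum.cong) (auto simp: power2_eq_square algebra_simps)
  also have "\<dots> = c n * m n"
    using assms by (simp add: d_def if_distrib[of "\<lambda>x. _ * x"] if_distrib[of "\<lambda>x. x * _"] sum.delta' cong: if_cong)
  finally show ?thesis .
qed

lemma L2_dist_S:
  assumes "memLq 2 g"
  shows "(LINT t|U. (S c N t - g t)\<^sup>2) =
    (LINT t|U. (g t)\<^sup>2) - (\<Sum>n<N. (coef g n)\<^sup>2 * m n) + (\<Sum>n<N. (c n - coef g n)\<^sup>2 * m n)"
proof -
  have "(LINT t|U. (S c N t - g t)\<^sup>2) = (LINT t|U. (S c N t)\<^sup>2 - 2 * (g t * S c N t) + (g t)\<^sup>2)"
    by (intro Bochner_Integration.integral_cong) (auto simp: power2_eq_square algebra_simps)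
  also have "\<dots> = (\<Sum>n<N. (c n)\<^sup>2 * m n) - 2 * (\<Sum>n<N. c n * coef g n * m n) + (LINT t|U. (g t)\<^sup>2)"
    using assms S_L2[of c N] integrable_mult_L2[OF assms S_L2]
    by (simp add: memLq_2_iff inner_S[OF assms] second_moment_S)
  also have "\<dots> = (LINT t|U. (g t)\<^sup>2) + (\<Sum>n<N. (c n)\<^sup>2 * m n - 2 * (c n * coef g n * m n))"
    by (simp add: sum_subtractf sum_distrib_left)
  also have "(\<Sum>n<N. (c n)\<^sup>2 * m n - 2 * (c n * coef g n * m n))
      = (\<Sum>n<N. (c n - coef g n)\<^sup>2 * m n - (coef g n)\<^sup>2 * m n)"
    by (intro sum.cong) (auto simp: power2_eq_square algebra_simps)
  finally show ?thesis by (simp add: sum_subtractf)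
qed

lemma bessel:
  assumes "memLq 2 g"
  shows "(\<Sum>n<N. (coef g n)\<^sup>2 * m n) \<le> (LINT t|U. (g t)\<^sup>2)"
proof -
  have "0 \<le> (LINT t|U. (S (coef g) N t - g t)\<^sup>2)" by simp
  then show ?thesis unfolding L2_dist_S[OF assms] by simp
qed

text \<open>Duality: test \<open>g\<close> against \<open>\<Sum> d\<^sub>n f\<^sub>n\<close> with \<open>\<bar>d\<^sub>n\<bar> = \<bar>coef g n\<bar>\<^bsup>p-1\<^esup>\<close>. As the span of the \<open>f\<^sub>n\<close> satisfies an
  upper \<open>q\<close>-estimate with constant 1, Young's inequality already gives the sharp bound.\<close>

lemma coef_powr_sum_le:
  assumes p: "2 < p" and g: "memLq p g"
  shows "(\<Sum>n<N. \<bar>coef g n\<bar> powr p * m n) \<le> (LINT t|U. \<bar>g t\<bar> powr p)"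
proof -
  define q where "q = p / (p - 1)"
  have q: "1 \<le> q" "q \<le> 2" "1 < q" "1 / p + 1 / q = 1" "(p - 1) * q = p"
    using p by (auto simp: q_def field_simps)
  define d where "d n = sgn (coef g n) * \<bar>coef g n\<bar> powr (p - 1)" for n
  define E where "E = (\<Sum>n<N. \<bar>coef g n\<bar> powr p * m n)"
  have g2: "memLq 2 g" by (rule memLq_imp_L2[OF p g])
  have dq: "\<bar>d n\<bar> powr q = \<bar>coef g n\<bar> powr p" for n
  proof (cases "coef g n = 0")
    case False
    then have "\<bar>d n\<bar> = \<bar>coef g n\<bar> powr (p - 1)"
      by (simp add: d_def abs_mult)
    then show ?thesis by (simp add: powr_powr q)
  qed (use p q in \<open>simp add: d_def\<close>)
  have db: "d n * coef g n = \<bar>coef g n\<bar> powr p" for n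
  proof (cases "coef g n = 0")
    case False
    have "d n * coef g n = \<bar>coef g n\<bar> powr (p - 1) * (sgn (coef g n) * coef g n)"
      by (simp add: d_def)
    also have "sgn (coef g n) * coef g n = \<bar>coef g n\<bar>"
      by (simp add: abs_sgn mult.commute)
    also have "\<bar>coef g n\<bar> powr (p - 1) * \<bar>coef g n\<bar> = \<bar>coef g n\<bar> powr p"
      using False by (simp add: powr_diff)
    finally show ?thesis .
  qed (use p in \<open>simp add: d_def\<close>)
  have int: "integrable U (\<lambda>t. \<bar>S d N t\<bar> powr q)"
    using q by (intro integrable_continuous_S[of "\<lambda>x. \<bar>x\<bar> powr q"] continuous_on_abs_powr) auto
  have gp: "integrable U (\<lambda>t. \<bar>g t\<bar> powr p)" using g by (simp add: memLq_def)
  have "E = (LINT t|U. g t * S d N t)"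
    by (simp add: inner_S[OF g2] E_def db)
  also have "\<dots> \<le> (LINT t|U. \<bar>g t\<bar> powr p / p + \<bar>S d N t\<bar> powr q / q)"
  proof (rule integral_mono)
    show "g t * S d N t \<le> \<bar>g t\<bar> powr p / p + \<bar>S d N t\<bar> powr q / q" for t
    proof -
      have "g t * S d N t \<le> \<bar>g t\<bar> * \<bar>S d N t\<bar>"
        by (simp flip: abs_mult)
      also have "\<dots> \<le> \<bar>g t\<bar> powr p / p + \<bar>S d N t\<bar> powr q / q"
        using p q by (intro Youngs_inequality) auto
      finally show ?thesis .
    qed
  qed (use int gp integrable_mult_L2[OF g2 S_L2] in auto)
  also have "\<dots> = (LINT t|U. \<bar>g t\<bar> powr p) / p + (LINT t|U. \<bar>S d N t\<bar> powr q) / q"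
    using int gp by simp
  also have "\<dots> \<le> (LINT t|U. \<bar>g t\<bar> powr p) / p + E / q"
    using moment_S_le_sum[of q d N] q by (intro add_left_mono divide_right_mono) (auto simp: dq E_def)
  finally have "E - E / q \<le> (LINT t|U. \<bar>g t\<bar> powr p) / p" by simp
  also have "E - E / q = E * (1 - 1 / q)" by (simp add: algebra_simps)
  also have "1 - 1 / q = 1 / p" using q by simp
  finally show ?thesis using p by (simp add: E_def divide_right_mono field_simps)
qed

definition L2_sums :: "(nat \<Rightarrow> real) \<Rightarrow> (real \<Rightarrow> real) \<Rightarrow> bool" where
  "L2_sums c g \<longleftrightarrow> memLq 2 g \<and> (\<lambda>N. LINT t|U. (S c N t - g t)\<^sup>2) \<longlonglongrightarrow> 0"

lemma L2_sums_unique: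
  assumes g: "L2_sums c g" and h: "L2_sums c h"
  shows "ae_eq g h"
proof (rule ae_eq_if_L2_dist_0)
  show g2: "memLq 2 g" and h2: "memLq 2 h" using g h by (simp_all add: L2_sums_def)
  let ?F = "\<lambda>N. 2 * (LINT t|U. (g t - S c N t)\<^sup>2) + 2 * (LINT t|U. (S c N t - h t)\<^sup>2)"
  have "(\<lambda>N. LINT t|U. (g t - S c N t)\<^sup>2) \<longlonglongrightarrow> 0" "(\<lambda>N. LINT t|U. (S c N t - h t)\<^sup>2) \<longlonglongrightarrow> 0"
    using g h by (simp_all only: L2_sums_def L2_dist_commute[of g "S _ _"])
  then have lim: "?F \<longlonglongrightarrow> 2 * 0 + 2 * 0"
    by (intro tendsto_intros)
  have le: "(LINT t|U. (g t - h t)\<^sup>2) \<le> ?F N" for N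
    by (rule L2_triangle[OF g2 S_L2 h2])
  have "(LINT t|U. (g t - h t)\<^sup>2) \<le> 2 * 0 + 2 * 0"
    by (rule LIMSEQ_le_const[OF lim]) (use le in blast)
  then show "(LINT t|U. (g t - h t)\<^sup>2) \<le> 0" by simp
qed

lemma L2_sums_linear:
  assumes g: "L2_sums c g" and h: "L2_sums d h"
  shows "L2_sums (\<lambda>n. a * c n + b * d n) (\<lambda>t. a * g t + b * h t)"
proof -
  have g2: "memLq 2 g" and h2: "memLq 2 h" using g h by (simp_all add: L2_sums_def)
  have int: "integrable U (\<lambda>t. (S c N t - g t)\<^sup>2)" "integrable U (\<lambda>t. (S d N t - h t)\<^sup>2)" for N
    using memLq_2_diff[OF S_L2 g2] memLq_2_diff[OF S_L2 h2] by (simp_all add: memLq_2_iff)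
  let ?u = "\<lambda>N t. S (\<lambda>n. a * c n + b * d n) N t - (a * g t + b * h t)"
  have u2: "integrable U (\<lambda>t. (?u N t)\<^sup>2)" for N
    using memLq_2_diff[OF S_L2 memLq_2_linear[OF g2 h2]] by (simp add: memLq_2_iff)
  have "(LINT t|U. (?u N t)\<^sup>2)
      \<le> 2 * a\<^sup>2 * (LINT t|U. (S c N t - g t)\<^sup>2) + 2 * b\<^sup>2 * (LINT t|U. (S d N t - h t)\<^sup>2)" for N
  proof -
    have "(a * x + b * y)\<^sup>2 \<le> 2 * a\<^sup>2 * x\<^sup>2 + 2 * b\<^sup>2 * y\<^sup>2" for x y
    proof -
      have "0 \<le> (a * x - b * y)\<^sup>2" by simp
      then show ?thesis by (simp add: power2_eq_square algebra_simps)
    qed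
    moreover have "?u N t = a * (S c N t - g t) + b * (S d N t - h t)" for t
      by (simp add: S_linear algebra_simps)
    ultimately have "(?u N t)\<^sup>2 \<le> 2 * a\<^sup>2 * (S c N t - g t)\<^sup>2 + 2 * b\<^sup>2 * (S d N t - h t)\<^sup>2" for t
      by (simp only:)
    then have "(LINT t|U. (?u N t)\<^sup>2)
        \<le> (LINT t|U. 2 * a\<^sup>2 * (S c N t - g t)\<^sup>2 + 2 * b\<^sup>2 * (S d N t - h t)\<^sup>2)"
      using int u2 by (intro integral_mono) auto
    then show ?thesis using int by simp
  qed
  moreover have "(\<lambda>N. 2 * a\<^sup>2 * (LINT t|U. (S c N t - g t)\<^sup>2) + 2 * b\<^sup>2 * (LINT t|U. (S d N t - h t)\<^sup>2))
      \<longlonglongrightarrow> 2 * a\<^sup>2 * 0 + 2 * b\<^sup>2 * 0"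
    using g h unfolding L2_sums_def by (intro tendsto_intros) auto
  ultimately have "(\<lambda>N. LINT t|U. (?u N t)\<^sup>2) \<longlonglongrightarrow> 0"
    by (intro tendsto_sandwich[where f = "\<lambda>_. 0" and g = "\<lambda>N. LINT t|U. (?u N t)\<^sup>2"]) auto
  then show ?thesis
    using memLq_2_linear[OF g2 h2] by (simp add: L2_sums_def)
qed

lemma L2_sums_inner:
  assumes g: "L2_sums c g" and h: "memLq 2 h"
  shows "(\<lambda>N. LINT t|U. S c N t * h t) \<longlonglongrightarrow> (LINT t|U. g t * h t)"
proof -
  have g2: "memLq 2 g" using g by (simp add: L2_sums_def)
  have "(\<lambda>N. LINT t|U. (S c N t - g t) * h t) \<longlonglongrightarrow> 0"
    using g by (intro tendsto_integral_mult_L2 memLq_2_diff S_L2 h g2) (simp add: L2_sums_def)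
  moreover have "(LINT t|U. (S c N t - g t) * h t) = (LINT t|U. S c N t * h t) - (LINT t|U. g t * h t)" for N
    using integrable_mult_L2[OF S_L2 h] integrable_mult_L2[OF g2 h] by (simp add: left_diff_distrib)
  ultimately show ?thesis by (simp add: LIM_zero_iff)
qed

lemma coef_L2_sums:
  assumes "L2_sums c g"
  shows "coef g = c"
proof
  fix n
  have "eventually (\<lambda>N. (LINT t|U. S c N t * f n t) = c n * m n) sequentially"
    using coef_S by (intro eventually_sequentiallyI[of "Suc n"]) auto
  then have "(\<lambda>N. LINT t|U. S c N t * f n t) \<longlonglongrightarrow> c n * m n"
    by (rule tendsto_eventually)
  then have "(LINT t|U. g t * f n t) = c n * m n"
    using L2_sums_inner[OF assms f_L2] LIMSEQ_unique by blast
  then show "coef g n = c n"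
    using m_pos[of n] by (simp add: coef_def)
qed

lemma L2_sums_exists:
  assumes "summable (\<lambda>n. (c n)\<^sup>2 * m n)"
  shows "\<exists>g. L2_sums c g \<and> (\<exists>r. strict_mono r \<and> (AE t in U. (\<lambda>k. S c (r k) t) \<longlonglongrightarrow> g t))"
proof -
  have diff: "(LINT t|U. (S c i t - S c j t)\<^sup>2) = (\<Sum>n=j..<i. (c n)\<^sup>2 * m n)" if "j \<le> i" for i j
  proof -
    define d where "d n = (if n < j then 0 else c n)" for n
    have "S c i t - S c j t = S d i t" for t
    proof -
      have "S c i t = S c j t + (\<Sum>n=j..<i. c n * f n t)"
        unfolding S_def by (rule sum_lessThan_split[OF that])
      moreover have "S d i t = (\<Sum>n<j. d n * f n t) + (\<Sum>n=j..<i. d n * f n t)"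
        unfolding S_def by (rule sum_lessThan_split[OF that])
      moreover have "(\<Sum>n<j. d n * f n t) = 0" "(\<Sum>n=j..<i. d n * f n t) = (\<Sum>n=j..<i. c n * f n t)"
        by (auto simp: d_def intro: sum.cong)
      ultimately show ?thesis by linarith
    qed
    then have "(LINT t|U. (S c i t - S c j t)\<^sup>2) = (\<Sum>n<i. (d n)\<^sup>2 * m n)"
      by (simp only: second_moment_S)
    also have "\<dots> = (\<Sum>n<j. (d n)\<^sup>2 * m n) + (\<Sum>n=j..<i. (d n)\<^sup>2 * m n)"
      by (rule sum_lessThan_split[OF that])
    finally show ?thesis by (simp add: d_def)
  qed
  have cauchy: "\<exists>N. \<forall>i\<ge>N. \<forall>j\<ge>N. (LINT t|U. (S c i t - S c j t)\<^sup>2) < e" if "0 < e" for e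
  proof -
    have "\<exists>N. \<forall>j\<ge>N. \<forall>i. norm (\<Sum>n=j..<i. (c n)\<^sup>2 * m n) < e"
      using iffD1[OF summable_Cauchy assms] that by blast
    then obtain N where N: "\<And>j i. j \<ge> N \<Longrightarrow> norm (\<Sum>n=j..<i. (c n)\<^sup>2 * m n) < e"
      by blast
    have "(LINT t|U. (S c i t - S c j t)\<^sup>2) < e" if "i \<ge> N" "j \<ge> N" for i j
    proof (cases "j \<le> i")
      case True
      then show ?thesis using N[OF that(2), of i] by (simp only: diff real_norm_def abs_less_iff)
    next
      case False
      then show ?thesis using N[OF that(1), of j] 
        by (simp only: L2_dist_commute[of "S c i" "S c j"] diff[OF less_imp_le] not_le real_norm_def abs_less_iff)
    qed
    then show ?thesis by blast
  qed
  obtain g r where "memLq 2 g" "strict_mono r" "AE t in U. (\<lambda>k. S c (r k) t) \<longlonglongrightarrow> g t"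
    "(\<lambda>n. LINT t|U. (S c n t - g t)\<^sup>2) \<longlonglongrightarrow> 0"
    by (rule riesz_fischer_L2[of "S c", OF S_L2 cauchy])
  then show ?thesis unfolding L2_sums_def by (intro exI[of _ g] conjI exI[of _ r])
qed

definition series :: "(nat \<Rightarrow> real) \<Rightarrow> real \<Rightarrow> real" where
  "series c = (SOME g. L2_sums c g \<and> (\<exists>r. strict_mono r \<and> (AE t in U. (\<lambda>k. S c (r k) t) \<longlonglongrightarrow> g t)))"

lemma series:
  assumes "summable (\<lambda>n. (c n)\<^sup>2 * m n)"
  shows L2_sums_series: "L2_sums c (series c)"
    and series_AE_subseq: "\<exists>r. strict_mono r \<and> (AE t in U. (\<lambda>k. S c (r k) t) \<longlonglongrightarrow> series c t)"
  using someI_ex[OF L2_sums_exists[OF assms]] by (simp_all add: series_def)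

lemma series_Lp:
  assumes p: "2 < p" and R: "0 \<le> R"
    and cp: "\<And>N. (\<Sum>n<N. \<bar>c n\<bar> powr p * m n) \<le> R powr p"
    and c2: "\<And>N. (\<Sum>n<N. (c n)\<^sup>2 * m n) \<le> R\<^sup>2"
  shows "memLq p (series c)" and "normLq p (series c) \<le> 7.35 * (p / ln p) * R"
proof -
  let ?K = "7.35 * (p / ln p) * R"
  have K: "0 \<le> ?K" using p R by simp
  have "summable (\<lambda>n. (c n)\<^sup>2 * m n)"
    using c2 m_pos by (intro summableI_nonneg_bounded[where x = "R\<^sup>2"]) (auto simp: less_imp_le)
  note sc = series[OF this]
  obtain r where r: "AE t in U. (\<lambda>k. S c (r k) t) \<longlonglongrightarrow> series c t"
    using sc(2) by auto
  have meas: "series c \<in> borel_measurable U"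
    using sc(1) by (auto simp: L2_sums_def memLq_def)
  have lim: "AE t in U. (\<lambda>k. \<bar>S c (r k) t\<bar> powr p) \<longlonglongrightarrow> \<bar>series c t\<bar> powr p"
    using r
  proof eventually_elim
    case (elim t)
    have "isCont (\<lambda>x. \<bar>x\<bar> powr p) (series c t)"
      using continuous_on_abs_powr[of p] p by (simp add: continuous_on_eq_continuous_at)
    then show ?case using elim by (rule isCont_tendsto_compose)
  qed
  have int: "integrable U (\<lambda>t. \<bar>S c (r k) t\<bar> powr p)" for k
    using p by (intro integrable_continuous_S[of "\<lambda>x. \<bar>x\<bar> powr p"] continuous_on_abs_powr) auto
  have meas': "(\<lambda>t. \<bar>series c t\<bar> powr p) \<in> borel_measurable U"
    using meas by measurable
  note fatou = fatou_integral_le[OF int powr_ge_zero meas' lim rosenthal[OF p R cp c2]]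
  show "memLq p (series c)"
    using fatou(1) meas by (simp add: memLq_def)
  have "normLq p (series c) \<le> (?K powr p) powr (1 / p)"
    unfolding normLq_def using fatou(2) p by (intro powr_mono2) auto
  then show "normLq p (series c) \<le> ?K"
    using K p by (simp add: powr_powr)
qed

definition proj :: "(real \<Rightarrow> real) \<Rightarrow> real \<Rightarrow> real" where
  "proj g = series (coef g)"

lemma summable_coef:
  assumes "memLq 2 g"
  shows "summable (\<lambda>n. (coef g n)\<^sup>2 * m n)"
  using bessel[OF assms] m_pos
  by (intro summableI_nonneg_bounded[where x = "LINT t|U. (g t)\<^sup>2"]) (auto simp: less_imp_le)

lemma L2_sums_proj: "memLq 2 g \<Longrightarrow> L2_sums (coef g) (proj g)"
  unfolding proj_def by (intro L2_sums_series summable_coef)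

lemma proj_L2: "memLq 2 g \<Longrightarrow> memLq 2 (proj g)"
  using L2_sums_proj by (simp add: L2_sums_def)

lemma proj_series: "summable (\<lambda>n. (c n)\<^sup>2 * m n) \<Longrightarrow> proj (series c) = series c"
  unfolding proj_def by (simp add: coef_L2_sums[OF L2_sums_series])

lemma inner_proj:
  assumes g: "memLq 2 g" and h: "memLq 2 h"
  shows "(\<lambda>N. \<Sum>n<N. coef g n * coef h n * m n) \<longlonglongrightarrow> (LINT t|U. proj g t * h t)"
  using L2_sums_inner[OF L2_sums_proj[OF g] h] inner_S[OF h, of "coef g"] by (simp add: mult.commute)

lemma coef_linear:
  assumes g: "memLq 2 g" and h: "memLq 2 h"
  shows "coef (\<lambda>t. a * g t + b * h t) = (\<lambda>n. a * coef g n + b * coef h n)"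
proof
  fix n
  have "(LINT t|U. (a * g t + b * h t) * f n t) = (LINT t|U. a * (g t * f n t) + b * (h t * f n t))"
    by (simp add: algebra_simps)
  also have "\<dots> = a * (LINT t|U. g t * f n t) + b * (LINT t|U. h t * f n t)"
    using integrable_mult_L2[OF g f_L2] integrable_mult_L2[OF h f_L2] by simp
  finally show "coef (\<lambda>t. a * g t + b * h t) n = a * coef g n + b * coef h n"
    by (simp add: coef_def add_divide_distrib)
qed

lemma proj_linear:
  assumes g: "memLq 2 g" and h: "memLq 2 h"
  shows "ae_eq (proj (\<lambda>t. a * g t + b * h t)) (\<lambda>t. a * proj g t + b * proj h t)"
proof (rule L2_sums_unique)
  show "L2_sums (\<lambda>n. a * coef g n + b * coef h n) (proj (\<lambda>t. a * g t + b * h t))"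
    using L2_sums_proj[OF memLq_2_linear[OF g h, of a b]] by (simp only: coef_linear[OF g h])
  show "L2_sums (\<lambda>n. a * coef g n + b * coef h n) (\<lambda>t. a * proj g t + b * proj h t)"
    by (rule L2_sums_linear[OF L2_sums_proj[OF g] L2_sums_proj[OF h]])
qed

lemma proj_self_adjoint:
  assumes g: "memLq 2 g" and h: "memLq 2 h"
  shows "(LINT t|U. proj g t * h t) = (LINT t|U. g t * proj h t)"
proof -
  have "(\<lambda>N. \<Sum>n<N. coef g n * coef h n * m n) \<longlonglongrightarrow> (LINT t|U. proj h t * g t)"
    using inner_proj[OF h g] by (simp only: mult.commute[of "coef h _" "coef g _"])
  then show ?thesis
    using LIMSEQ_unique[OF inner_proj[OF g h]] by (simp only: mult.commute[of "g _" "proj h _"])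
qed

lemma proj_cong:
  assumes g: "memLq 2 g" and h: "memLq 2 h" and ae: "ae_eq g h"
  shows "proj g = proj h"
proof -
  have "(LINT t|U. g t * f n t) = (LINT t|U. h t * f n t)" for n
  proof (rule integral_cong_AE)
    show "(\<lambda>t. g t * f n t) \<in> borel_measurable U" "(\<lambda>t. h t * f n t) \<in> borel_measurable U"
      using g h by (auto simp: memLq_def)
    show "AE t in U. g t * f n t = h t * f n t"
      using ae unfolding ae_eq_def by eventually_elim simp
  qed
  then have "coef g = coef h" by (simp add: coef_def fun_eq_iff)
  then show ?thesis by (simp add: proj_def)
qed

lemma proj_idem: "memLq 2 g \<Longrightarrow> proj (proj g) = proj g"
  unfolding proj_def[of g] by (intro proj_series summable_coef)

lemma orth_proj_proj: "orth_proj_L2 proj"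
  unfolding orth_proj_L2_def
proof (intro conjI allI impI)
  show "memLq 2 (proj g)" if "memLq 2 g" for g
    using that by (rule proj_L2)
  show "ae_eq (proj g) (proj h)" if "memLq 2 g" "memLq 2 h" "ae_eq g h" for g h
    unfolding proj_cong[OF that] by (rule ae_eq_refl)
  show "ae_eq (proj (\<lambda>t. a * g t + b * h t)) (\<lambda>t. a * proj g t + b * proj h t)"
    if "memLq 2 g" "memLq 2 h" for g h a b
    using that by (rule proj_linear)
  show "ae_eq (proj (proj g)) (proj g)" if "memLq 2 g" for g
    unfolding proj_idem[OF that] by (rule ae_eq_refl)
  show "(LINT t|U. proj g t * h t) = (LINT t|U. g t * proj h t)" if "memLq 2 g" "memLq 2 h" for g h
    using that by (rule proj_self_adjoint)
qed

lemma proj_Lp: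
  assumes p: "2 < p" and g: "memLq p g"
  shows "memLq p (proj g)" "normLq p (proj g) \<le> 7.35 * (p / ln p) * normLq p g"
proof -
  have 1: "(\<Sum>n<N. \<bar>coef g n\<bar> powr p * m n) \<le> normLq p g powr p" for N
    using coef_powr_sum_le[OF p g] p by (simp add: normLq_powr)
  have 2: "(\<Sum>n<N. (coef g n)\<^sup>2 * m n) \<le> (normLq p g)\<^sup>2" for N
    using bessel[OF memLq_imp_L2(1)[OF p g]] memLq_imp_L2(2)[OF p g] by (rule order_trans)
  show "memLq p (proj g)" "normLq p (proj g) \<le> 7.35 * (p / ln p) * normLq p g"
    unfolding proj_def by (rule series_Lp[OF p normLq_nonneg 1 2])+
qed

lemma p_C_bounded_proj: "2 < p \<Longrightarrow> p_C_bounded p (7.35 * (p / ln p)) proj"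
  unfolding p_C_bounded_def using proj_Lp by blast

lemma ae_eq_proj_closure:
  assumes p: "2 < p" and g: "g \<in> Lp_closure_range p proj"
  shows "ae_eq (proj g) g"
proof (rule ae_eq_if_L2_dist_0)
  have gp: "memLq p g" using g by (simp add: Lp_closure_range_def)
  then show g2: "memLq 2 g" by (rule memLq_imp_L2[OF p])
  then show Pg: "memLq 2 (proj g)" by (rule proj_L2)
  show "(LINT t|U. (proj g t - g t)\<^sup>2) \<le> 0"
  proof (rule field_le_epsilon)
    fix e :: real assume e: "0 < e"
    obtain h where h2: "memLq 2 h" and hp: "memLq p h"
      and h: "normLq p (\<lambda>t. g t - proj h t) < sqrt (e / 4)"
      using g e unfolding Lp_closure_range_def by (auto dest!: spec[of _ "sqrt (e / 4)"])
    have Ph: "memLq 2 (proj h)" by (rule proj_L2[OF h2])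
    have up: "memLq p (\<lambda>t. g t - proj h t)"
      using p by (intro memLq_diff gp proj_Lp(1)[OF p hp]) auto
    have "(LINT t|U. (g t - proj h t)\<^sup>2) \<le> (normLq p (\<lambda>t. g t - proj h t))\<^sup>2"
      by (rule memLq_imp_L2(2)[OF p up])
    also have "\<dots> \<le> (sqrt (e / 4))\<^sup>2"
      using h normLq_nonneg by (intro power_mono) auto
    finally have close: "(LINT t|U. (proj h t - g t)\<^sup>2) \<le> e / 4"
      using e unfolding L2_dist_commute[of g] by simp
    have best: "(LINT t|U. (S (coef g) N t - g t)\<^sup>2) \<le> (LINT t|U. (S (coef h) N t - g t)\<^sup>2)" for N
      unfolding L2_dist_S[OF g2] using m_pos by (simp add: sum_nonneg less_imp_le)
    have "(LINT t|U. (proj g t - g t)\<^sup>2) \<le> 2 * (LINT t|U. (proj g t - S (coef g) N t)\<^sup>2)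
        + 2 * (2 * (LINT t|U. (S (coef h) N t - proj h t)\<^sup>2) + 2 * (LINT t|U. (proj h t - g t)\<^sup>2))" for N
    proof -
      have "(LINT t|U. (proj g t - g t)\<^sup>2)
          \<le> 2 * (LINT t|U. (proj g t - S (coef g) N t)\<^sup>2) + 2 * (LINT t|U. (S (coef g) N t - g t)\<^sup>2)"
        by (rule L2_triangle[OF Pg S_L2 g2])
      also have "(LINT t|U. (S (coef g) N t - g t)\<^sup>2)
          \<le> 2 * (LINT t|U. (S (coef h) N t - proj h t)\<^sup>2) + 2 * (LINT t|U. (proj h t - g t)\<^sup>2)"
        by (rule order_trans[OF best L2_triangle[OF S_L2 Ph g2]])
      finally show ?thesis by simp
    qed
    moreover have "(\<lambda>N. 2 * (LINT t|U. (proj g t - S (coef g) N t)\<^sup>2)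
        + 2 * (2 * (LINT t|U. (S (coef h) N t - proj h t)\<^sup>2) + 2 * (LINT t|U. (proj h t - g t)\<^sup>2)))
        \<longlonglongrightarrow> 2 * 0 + 2 * (2 * 0 + 2 * (LINT t|U. (proj h t - g t)\<^sup>2))"
      using L2_sums_proj[OF g2] L2_sums_proj[OF h2] unfolding L2_sums_def L2_dist_commute[of "proj g" "S _ _"]
      by (intro tendsto_intros) auto
    ultimately have "(LINT t|U. (proj g t - g t)\<^sup>2) \<le> 2 * 0 + 2 * (2 * 0 + 2 * (LINT t|U. (proj h t - g t)\<^sup>2))"
      by (intro LIMSEQ_le_const) auto
    then show "(LINT t|U. (proj g t - g t)\<^sup>2) \<le> 0 + e" using close by simp
  qed
qed

end

subsection \<open>The isomorphism with the Rosenthal space\<close>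

lemma powr_sum_le_norm_Xpw:
  assumes p: "2 < p" and x: "in_Xpw p w x"
  shows "(\<Sum>n<N. \<bar>x n\<bar> powr p) \<le> norm_Xpw p w x powr p"
    and "(\<Sum>n<N. (x n * w n)\<^sup>2) \<le> (norm_Xpw p w x)\<^sup>2"
proof -
  let ?A = "\<Sum>n. \<bar>x n\<bar> powr p" and ?B = "\<Sum>n. (x n * w n)\<^sup>2"
  have sA: "summable (\<lambda>n. \<bar>x n\<bar> powr p)" and sB: "summable (\<lambda>n. (x n * w n)\<^sup>2)"
    using x by (simp_all add: in_Xpw_def)
  have A: "0 \<le> ?A" and B: "0 \<le> ?B" using sA sB by (auto intro: suminf_nonneg)
  have "(\<Sum>n<N. \<bar>x n\<bar> powr p) \<le> ?A"
    using sA by (intro sum_le_suminf) auto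
  also have "?A = (?A powr (1 / p)) powr p"
    using A p by (simp add: powr_powr)
  also have "\<dots> \<le> norm_Xpw p w x powr p"
    using p by (intro powr_mono2) (auto simp: norm_Xpw_def)
  finally show "(\<Sum>n<N. \<bar>x n\<bar> powr p) \<le> norm_Xpw p w x powr p" .
  have "(\<Sum>n<N. (x n * w n)\<^sup>2) \<le> ?B"
    using sB by (intro sum_le_suminf) auto
  also have "?B = (sqrt ?B)\<^sup>2"
    using B by simp
  also have "\<dots> \<le> (norm_Xpw p w x)\<^sup>2"
    using B by (intro power_mono) (auto simp: norm_Xpw_def)
  finally show "(\<Sum>n<N. (x n * w n)\<^sup>2) \<le> (norm_Xpw p w x)\<^sup>2" .
qed

lemma norm_Xpw_le:
  assumes p: "2 < p" and K: "0 \<le> K"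
    and 1: "\<And>N. (\<Sum>n<N. \<bar>x n\<bar> powr p) \<le> K powr p"
    and 2: "\<And>N. (\<Sum>n<N. (x n * w n)\<^sup>2) \<le> K\<^sup>2"
  shows "in_Xpw p w x" and "norm_Xpw p w x \<le> K"
proof -
  have sA: "summable (\<lambda>n. \<bar>x n\<bar> powr p)"
    by (rule summableI_nonneg_bounded[OF _ 1]) simp
  have sB: "summable (\<lambda>n. (x n * w n)\<^sup>2)"
    by (rule summableI_nonneg_bounded[OF _ 2]) simp
  show "in_Xpw p w x" using sA sB by (simp add: in_Xpw_def)
  have "(\<Sum>n. \<bar>x n\<bar> powr p) powr (1 / p) \<le> (K powr p) powr (1 / p)"
    using p by (intro powr_mono2 suminf_le_const[OF sA 1] suminf_nonneg[OF sA]) auto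
  moreover have "sqrt (\<Sum>n. (x n * w n)\<^sup>2) \<le> K"
    using K by (intro real_le_lsqrt suminf_le_const[OF sB 2])
  ultimately show "norm_Xpw p w x \<le> K"
    using K p by (simp add: norm_Xpw_def powr_powr)
qed

context symmetric_spikes
begin

text \<open>The normalisation makes \<open>f\<^sub>n / m\<^sub>n\<^bsup>1/p\<^esup>\<close> a unit vector of \<open>L\<^sub>p\<close> whose \<open>L\<^sub>2\<close> norm is
  \<open>m\<^sub>n\<^bsup>1/2-1/p\<^esup>\<close>, which is to be comparable with \<open>w\<^sub>n\<close>.\<close>

lemma Xpw_isomorphic_closure_proj:
  assumes p: "2 < p" and k1: "0 < k1" and k2: "0 < k2"
    and low: "\<And>n. k1 * (w n)\<^sup>2 \<le> m n powr (1 - 2 / p)"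
    and up: "\<And>n. m n powr (1 - 2 / p) \<le> k2 * (w n)\<^sup>2"
  shows "Xpw_isomorphic_to p w (Lp_closure_range p proj)"
proof -
  define C where "C x n = x n * m n powr (- 1 / p)" for x and n :: nat
  define T where "T x = series (C x)" for x
  have Cp: "\<bar>C x n\<bar> powr p * m n = \<bar>x n\<bar> powr p" for x n
  proof -
    have "(m n powr (- 1 / p)) powr p = m n powr (- 1)"
      unfolding powr_powr using p by simp
    then have *: "(m n powr (- 1 / p)) powr p * m n = 1"
      using m_pos[of n] by (simp add: powr_minus)
    have "\<bar>C x n\<bar> powr p * m n = \<bar>x n\<bar> powr p * ((m n powr (- 1 / p)) powr p * m n)"
      by (simp add: C_def abs_mult powr_mult)
    then show ?thesis unfolding * by simp
  qed
  have C2: "(C x n)\<^sup>2 * m n = (x n)\<^sup>2 * m n powr (1 - 2 / p)" for x n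
  proof -
    have "(m n powr (- 1 / p))\<^sup>2 * m n = m n powr (- 1 / p + - 1 / p + 1)"
      using m_pos[of n] by (simp only: powr_add power2_eq_square) simp
    also have "- 1 / p + - 1 / p + 1 = 1 - 2 / p" by simp
    finally show ?thesis by (simp add: C_def power_mult_distrib)
  qed
  have C2_up: "(C x n)\<^sup>2 * m n \<le> k2 * (x n * w n)\<^sup>2" and C2_low: "k1 * (x n * w n)\<^sup>2 \<le> (C x n)\<^sup>2 * m n" for x n
    using mult_left_mono[OF up[of n] zero_le_power2[of "x n"]] mult_left_mono[OF low[of n] zero_le_power2[of "x n"]]
    by (simp_all add: C2 power_mult_distrib mult.left_commute)
  define b where "b = max 1 (sqrt k2)"
  have b: "1 \<le> b" "k2 \<le> b\<^sup>2"
  proof -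
    show "1 \<le> b" by (simp add: b_def)
    have "(sqrt k2)\<^sup>2 \<le> b\<^sup>2" using k2 by (intro power_mono) (auto simp: b_def)
    then show "k2 \<le> b\<^sup>2" using k2 by simp
  qed
  define a where "a = min 1 (sqrt k1)"
  have a: "0 < a" "a \<le> 1" "a\<^sup>2 \<le> k1"
  proof -
    show a0: "0 < a" "a \<le> 1" using k1 by (simp_all add: a_def)
    have "a\<^sup>2 \<le> (sqrt k1)\<^sup>2" using a0 by (intro power_mono) (auto simp: a_def)
    then show "a\<^sup>2 \<le> k1" using k1 by simp
  qed
  have bound: "(\<Sum>n<N. \<bar>C x n\<bar> powr p * m n) \<le> (b * norm_Xpw p w x) powr p"
    "(\<Sum>n<N. (C x n)\<^sup>2 * m n) \<le> (b * norm_Xpw p w x)\<^sup>2" "0 \<le> b * norm_Xpw p w x"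
    if x: "in_Xpw p w x" for x N
  proof -
    have n0: "0 \<le> norm_Xpw p w x" by (simp add: norm_Xpw_def le_max_iff_disj)
    show "0 \<le> b * norm_Xpw p w x" using n0 b by simp
    have "norm_Xpw p w x powr p \<le> (b * norm_Xpw p w x) powr p"
      using n0 b p by (intro powr_mono2) (auto simp: mult_le_cancel_right1)
    then show "(\<Sum>n<N. \<bar>C x n\<bar> powr p * m n) \<le> (b * norm_Xpw p w x) powr p"
      unfolding Cp by (rule order_trans[OF powr_sum_le_norm_Xpw(1)[OF p x]])
    have "(\<Sum>n<N. (C x n)\<^sup>2 * m n) \<le> k2 * (\<Sum>n<N. (x n * w n)\<^sup>2)"
      unfolding sum_distrib_left by (intro sum_mono C2_up)
    also have "\<dots> \<le> b\<^sup>2 * (norm_Xpw p w x)\<^sup>2"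
      using b k2 by (intro mult_mono powr_sum_le_norm_Xpw(2)[OF p x]) (auto intro: sum_nonneg)
    finally show "(\<Sum>n<N. (C x n)\<^sup>2 * m n) \<le> (b * norm_Xpw p w x)\<^sup>2"
      by (simp add: power_mult_distrib)
  qed
  have summ: "summable (\<lambda>n. (C x n)\<^sup>2 * m n)" if "in_Xpw p w x" for x
    using m_pos by (intro summableI_nonneg_bounded[OF _ bound(2)[OF that]]) (simp add: less_imp_le)
  have TLp: "memLq p (T x)" "normLq p (T x) \<le> 7.35 * (p / ln p) * (b * norm_Xpw p w x)"
    if "in_Xpw p w x" for x
    unfolding T_def by (rule series_Lp[OF p bound(3)[OF that] bound(1)[OF that] bound(2)[OF that]])+
  have TX: "T x \<in> Lp_closure_range p proj" if x: "in_Xpw p w x" for x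
  proof -
    have "proj (T x) = T x" unfolding T_def by (rule proj_series[OF summ[OF x]])
    then have "normLq p (\<lambda>t. T x t - proj (T x) t) = 0" using p by (simp add: normLq_def)
    then show ?thesis
      using TLp(1)[OF x] memLq_imp_L2(1)[OF p TLp(1)[OF x]]
      unfolding Lp_closure_range_def by (auto intro!: exI[of _ "T x"])
  qed
  have in_norm: "in_Xpw p w x" "a * norm_Xpw p w x \<le> normLq p g"
    if g: "memLq p g" and c: "coef g = C x" for g x
  proof -
    have g0: "0 \<le> normLq p g / a" using a normLq_nonneg by simp
    have le: "normLq p g \<le> normLq p g / a"
      using a normLq_nonneg[of p g] by (simp add: pos_le_divide_eq mult_left_le)
    have 1: "(\<Sum>n<N. \<bar>x n\<bar> powr p) \<le> (normLq p g / a) powr p" for N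
    proof -
      have "(\<Sum>n<N. \<bar>x n\<bar> powr p) \<le> normLq p g powr p"
        using coef_powr_sum_le[OF p g, of N] p by (simp add: c Cp normLq_powr)
      also have "\<dots> \<le> (normLq p g / a) powr p"
        using p le normLq_nonneg by (intro powr_mono2) auto
      finally show ?thesis .
    qed
    have 2: "(\<Sum>n<N. (x n * w n)\<^sup>2) \<le> (normLq p g / a)\<^sup>2" for N
    proof -
      have "a\<^sup>2 * (\<Sum>n<N. (x n * w n)\<^sup>2) \<le> k1 * (\<Sum>n<N. (x n * w n)\<^sup>2)"
        using a by (intro mult_right_mono sum_nonneg) auto
      also have "\<dots> \<le> (\<Sum>n<N. (coef g n)\<^sup>2 * m n)"
        unfolding sum_distrib_left c by (intro sum_mono C2_low)
      also have "\<dots> \<le> (normLq p g)\<^sup>2"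
        using bessel[OF memLq_imp_L2(1)[OF p g]] memLq_imp_L2(2)[OF p g] by (rule order_trans)
      finally show ?thesis using a by (simp add: power_divide field_simps)
    qed
    note norm_Xpw_le[OF p g0 1 2]
    then show "in_Xpw p w x" "a * norm_Xpw p w x \<le> normLq p g"
      using a by (simp_all add: field_simps)
  qed
  have lin: "ae_eq (T (\<lambda>n. c * x n + d * y n)) (\<lambda>t. c * T x t + d * T y t)"
    if x: "in_Xpw p w x" and y: "in_Xpw p w y" for x y c d
  proof (rule L2_sums_unique)
    have C: "C (\<lambda>n. c * x n + d * y n) = (\<lambda>n. c * C x n + d * C y n)"
      by (auto simp: C_def algebra_simps)
    have *: "L2_sums (C (\<lambda>n. c * x n + d * y n)) (\<lambda>t. c * T x t + d * T y t)"
      unfolding C T_def by (rule L2_sums_linear[OF L2_sums_series[OF summ[OF x]] L2_sums_series[OF summ[OF y]]])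
    then show "L2_sums (C (\<lambda>n. c * x n + d * y n)) (\<lambda>t. c * T x t + d * T y t)" .
    have "memLq 2 (\<lambda>t. c * T x t + d * T y t)" using * by (simp add: L2_sums_def)
    then have "summable (\<lambda>n. (C (\<lambda>n. c * x n + d * y n) n)\<^sup>2 * m n)"
      unfolding coef_L2_sums[OF *, symmetric] by (rule summable_coef)
    then show "L2_sums (C (\<lambda>n. c * x n + d * y n)) (T (\<lambda>n. c * x n + d * y n))"
      unfolding T_def by (rule L2_sums_series)
  qed
  have surj: "\<exists>x. in_Xpw p w x \<and> ae_eq (T x) g" if g: "g \<in> Lp_closure_range p proj" for g
  proof -
    define x where "x n = coef g n * m n powr (1 / p)" for n
    have c: "coef g = C x"
      using m_pos by (auto simp: C_def x_def powr_minus less_imp_neq[symmetric] fun_eq_iff)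
    have "T x = proj g" by (simp add: T_def proj_def c)
    moreover have "in_Xpw p w x"
      using g c by (intro in_norm(1)) (auto simp: Lp_closure_range_def)
    ultimately show ?thesis using ae_eq_proj_closure[OF p g] by (intro exI[of _ x]) simp
  qed
  define B where "B = 7.35 * (p / ln p) * b"
  have B: "0 < B" using p b by (simp add: B_def)
  have norms: "a * norm_Xpw p w x \<le> normLq p (T x) \<and> normLq p (T x) \<le> B * norm_Xpw p w x"
    if x: "in_Xpw p w x" for x
  proof
    have "coef (T x) = C x"
      unfolding T_def by (rule coef_L2_sums[OF L2_sums_series[OF summ[OF x]]])
    then show "a * norm_Xpw p w x \<le> normLq p (T x)" by (rule in_norm(2)[OF TLp(1)[OF x]])
    show "normLq p (T x) \<le> B * norm_Xpw p w x"
      using TLp(2)[OF x] by (simp add: B_def mult.assoc)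
  qed
  show ?thesis
    unfolding Xpw_isomorphic_to_def
    by (rule exI[of _ T], rule exI[of _ a], rule exI[of _ B])
      (use a(1) B TX lin norms surj in blast)
qed

end

theorem mainTheorem2:
  fixes p :: real and w :: "nat \<Rightarrow> real"
  assumes "2 < p"
    and "\<And>n. 0 < w n"
    and "w \<longlonglongrightarrow> 0"
    and "\<not> summable (\<lambda>n. w n powr (2 * p / (p - 2)))"
  shows "\<exists>X. C_orth_complemented p (7.35 * (p / ln p)) X \<and> Xpw_isomorphic_to p w X"
proof -
  note p = assms(1) and w_pos = assms(2)
  obtain W where W: "0 < W" "\<And>n. w n \<le> W"
    using convergent_imp_Bseq[OF convergentI[OF assms(3)]] by (auto simp: Bseq_def abs_le_iff)
  define y where "y n = (w n / W) powr (2 * p / (p - 2))" for n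
  have y: "0 < y n" "y n \<le> 1" for n
    using W w_pos[of n] p by (auto simp: y_def intro!: powr_le1)
  have y_powr: "y n powr (1 - 2 / p) = (w n / W)\<^sup>2" for n
  proof -
    have "(2 * p / (p - 2)) * (1 - 2 / p) = 2" using p by (simp add: field_simps)
    then show ?thesis
      using w_pos[of n] W by (simp add: y_def powr_powr powr_numeral)
  qed
  define M where "M n = nat \<lceil>2 / y n\<rceil>" for n
  have M_low: "2 / y n \<le> real (M n)" for n
    unfolding M_def by (rule real_nat_ceiling_ge)
  have M_up: "real (M n) \<le> 4 / y n" for n
  proof -
    have "real (M n) \<le> 2 / y n + 1"
      unfolding M_def using y[of n] of_int_ceiling_le_add_one[of "2 / y n"] by (simp add: ceiling_le_iff)
    moreover have "1 \<le> 2 / y n" using y[of n] by (simp add: field_simps)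
    moreover have "2 / y n + 2 / y n = 4 / y n" by simp
    ultimately show ?thesis by linarith
  qed
  have M2: "2 \<le> M n" for n
  proof -
    have "2 \<le> 2 / y n" using y[of n] by (simp add: field_simps)
    then show ?thesis using M_low[of n] by linarith
  qed
  define m where "m n = 2 / real (M n)" for n
  have m: "0 < m n" "m n \<le> y n" "y n \<le> 2 * m n" for n
    using M2[of n] M_low[of n] M_up[of n] y[of n] by (auto simp: m_def field_simps)
  interpret symmetric_spikes "spike_fun M" m
    unfolding m_def by (rule symmetric_spikes_spike_fun[OF M2])
  have e: "0 < 1 - 2 / p" "1 - 2 / p \<le> 1" using p by auto
  have "Xpw_isomorphic_to p w (Lp_closure_range p proj)"
  proof (rule Xpw_isomorphic_closure_proj[OF p])
    show "0 < 1 / (2 * W\<^sup>2)" "0 < 1 / W\<^sup>2" using W by simp_all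
    fix n
    have "(w n / W)\<^sup>2 \<le> (2 * m n) powr (1 - 2 / p)"
      unfolding y_powr[symmetric] using m[of n] y[of n] e by (intro powr_mono2) auto
    also have "\<dots> = 2 powr (1 - 2 / p) * m n powr (1 - 2 / p)"
      by (rule powr_mult)
    also have "\<dots> \<le> 2 powr 1 * m n powr (1 - 2 / p)"
      using e by (intro mult_right_mono powr_mono) auto
    finally show "1 / (2 * W\<^sup>2) * (w n)\<^sup>2 \<le> m n powr (1 - 2 / p)"
      by (simp add: power_divide field_simps)
    have "m n powr (1 - 2 / p) \<le> y n powr (1 - 2 / p)"
      using m[of n] e by (intro powr_mono2) auto
    then show "m n powr (1 - 2 / p) \<le> 1 / W\<^sup>2 * (w n)\<^sup>2"
      by (simp add: y_powr power_divide)
  qed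
  moreover have "C_orth_complemented p (7.35 * (p / ln p)) (Lp_closure_range p proj)"
    unfolding C_orth_complemented_def using orth_proj_proj p_C_bounded_proj[OF p] by blast
  ultimately show ?thesis by blast
qed

end
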